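(* Let $A\in\mathbb{R}^{n\times n}$, $T>0$, $X_0=c_x+G_x\mathbf{B}_{p_x}\in\mathbb{A}_n$ and $U=c_u+G_u\mathbf{B}_{p_u}\in\mathbb{A}_n$. Let $N\in\mathbb{N}$, $\epsilon_h,\epsilon_u\in[0,1)$, $\tau=T/N$, and assume $\tau\in\mathbb{I}$. Define $\mathcal{S}_0^N=X_0$, $\mathcal{S}_i^N=\mathcal{H}(\tau,\mathcal{S}_{i-1}^N,\epsilon_h)$ for $i\in\{1,\dots,N\}$; $\mathcal{V}_0^N=\mathcal{I}(\tau,U,\epsilon_u)$, $\mathcal{V}_i^N=\mathcal{H}(\tau,\mathcal{V}_{i-1}^N,\epsilon_h)$ for $i\in\{1,\dots,N\}$; $\mathcal{W}_0^N=\{0\}$, $\mathcal{W}_i^N=\mathcal{W}_{i-1}^N+\mathcal{V}_{i-1}^N$ for $i\in\{1,\dots,N\}$; $\Lambda_i^N=\mathcal{S}_i^N+\mathcal{W}_i^N$ for $i\in\{0,\dots,N\}$. Define also $S_0^N=X_0$, $S_i^N=\mathrm{e}^{\tau A}S_{i-1}^N$; $V_0^N=\mathcal{R}_u(\tau)$, $V_i^N=\mathrm{e}^{\tau A}V_{i-1}^N$; $W_0^N=\{0\}$, $W_i^N=W_{i-1}^N+V_{i-1}^N$; $\Gamma_i^N=S_i^N+W_i^N$. Then for all $i\in\{0,\dots,N\}$: $\mathcal{S}_i^N\subseteq S_i^N=\mathcal{R}_h(i\tau)$, $\mathcal{V}_i^N\subseteq V_i^N$, $\mathcal{W}_i^N\subseteq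 W_i^N=\mathcal{R}_u(i\tau)$ and $\Lambda_i^N\subseteq\Gamma_i^N=\mathcal{R}(i\tau)$. Furthermore $\bigcup_{i=0}^N\Lambda_i^N\subseteq\mathcal{R}([0,T])$.
   Context: A norm $\|\cdot\|$ is fixed on each $\mathbb{R}^k$, $\mathbf{B}_k$ is its closed unit ball, matrices carry induced norms, $G^\dagger$ is the Moore–Penrose inverse, $\rho(A)$ the spectral radius. $\mathbb{A}_n$ is the collection of sets $\Omega=c+G\mathbf{B}_p$ with $c\in\mathbb{R}^n$, $G\in\mathbb{R}^{n\times p}$, $\mathrm{rank}(G)=n$; such a set is always regarded together with its representation $(c,G)$. Minkowski sums and linear images are used; set-valued integral $\int_0^tF(s)W\,\mathrm{d}s=\bigcup_w\int_0^tF(s)w(s)\,\mathrm{d}s$ over measurable $w:[0,t]\to W$. Reachable sets: $\mathcal{R}_h(t)=\mathrm{e}^{tA}X_0$, $\mathcal{R}_u(t)=\int_0^t\mathrm{e}^{sA}U\,\mathrm{d}s$, $\mathcal{R}(t)=\mathcal{R}_h(t)+\mathcal{R}_u(t)$, $\mathcal{R}([0,T])=\bigcup_{t\in[0,T]}\mathcal{R}(t)$. $\mathbb{I}=\{t\ge0:\int_0^t\mathrm{e}^{sA}\mathrm{d}s\text{ invertible}\}$. $\mathcal{L}(t,k)=\sum_{j=0}^{k-1}(tA)^j/j!$, $\mathcal{T}(t,k)=\sum_{j=0}^{k-1}t^{j+1}A^j/(j+1)!$, $\theta(r,k)=\sum_{j=k}^\infty r^j/j!$. For $\Omega=c+G\mathbf{B}_p\in\mathbb{A}_n$: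 $\lambda(t,\Omega,k)=\dfrac{1-\mathrm{e}^{t\|A\|}\theta(t\|A\|,k)\|G^\dagger\|\|c\|}{1+\mathrm{e}^{t\|A\|}\theta(t\|A\|,k)\|G^\dagger\|\|G\|}$. $k_{\min}(t)=\min\{k\in\mathbb{N}:\theta(t\rho(A),k)\mathrm{e}^{t\rho(A)}<1\}$. $\kappa(t,\Omega,\epsilon)=\min\{k\in\mathbb{N}:\ k\ge\max(k_{\min}(t),2),\ \lambda(t,\Omega,k)>\epsilon\}$ for $t\ge0$, $\epsilon\in[0,1)$. $\eta(t,\Omega,\epsilon)=\min\{k\in\mathbb{N}:\lambda(t,\Omega,k)>\epsilon,\ \mathcal{T}(t,k)\text{ invertible}\}$ for $t\in\mathbb{I}$, $\epsilon\in[0,1)$. $\mathcal{H}(t,\Omega,\epsilon)=\mathcal{L}(t,\kappa)[c+\lambda(t,\Omega,\kappa)G\mathbf{B}_p]$ with $\kappa=\kappa(t,\Omega,\epsilon)$, represented with center $\mathcal{L}(t,\kappa)c$ and generator matrix $\lambda(t,\Omega,\kappa)\mathcal{L}(t,\kappa)G$. $\mathcal{I}(t,\Omega,\epsilon)=\mathcal{T}(t,\eta)[c+\lambda(t,\Omega,\eta)G\mathbf{B}_p]$ with $\eta=\eta(t,\Omega,\epsilon)$, represented with center $\mathcal{T}(t,\eta)c$ and generator matrix $\lambda(t,\Omega,\eta)\mathcal{T}(t,\eta)G$. *)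

theory Defs
  imports "HOL-Analysis.Analysis"
begin

definition is_norm :: "(real^'k \<Rightarrow> real) \<Rightarrow> bool" where
  "is_norm N \<longleftrightarrow> (\<forall>x. 0 \<le> N x) \<and> (\<forall>x. N x = 0 \<longleftrightarrow> x = 0)
     \<and> (\<forall>a x. N (a *\<^sub>R x) = \<bar>a\<bar> * N x) \<and> (\<forall>x y. N (x + y) \<le> N x + N y)"

definition opnorm :: "(real^'p \<Rightarrow> real) \<Rightarrow> (real^'m \<Rightarrow> real) \<Rightarrow> real^'p^'m \<Rightarrow> real" where
  "opnorm Np Nm M = Sup {Nm (M *v x) | x. Np x \<le> 1}"

definition unit_ball :: "(real^'p \<Rightarrow> real) \<Rightarrow> (real^'p) set" where
  "unit_ball Np = {x. Np x \<le> 1}"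

primrec mpow :: "real^'n^'n \<Rightarrow> nat \<Rightarrow> real^'n^'n" where
  "mpow A 0 = mat 1"
| "mpow A (Suc k) = A ** mpow A k"

definition mexp :: "real \<Rightarrow> real^'n^'n \<Rightarrow> real^'n^'n" where
  "mexp t A = (\<Sum>j. (t ^ j / fact j) *\<^sub>R mpow A j)"

definition pinv :: "real^'p^'n \<Rightarrow> real^'n^'p" where
  "pinv G = (THE X. G ** X ** G = G \<and> X ** G ** X = X
               \<and> transpose (G ** X) = G ** X \<and> transpose (X ** G) = X ** G)"

definition spectral_radius :: "real^'n^'n \<Rightarrow> real" where
  "spectral_radius A = Max {cmod l | l. \<exists>v::complex^'n. v \<noteq> 0 \<and>
       (\<chi> i j. complex_of_real (A $ i $ j)) *v v = l *s v}"

definition msum :: "'a::plus set \<Rightarrow> 'a set \<Rightarrow> 'a set" where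
  "msum X Y = {x + y | x y. x \<in> X \<and> y \<in> Y}"

definition zset :: "(real^'p \<Rightarrow> real) \<Rightarrow> (real^'n) \<times> (real^'p^'n) \<Rightarrow> (real^'n) set" where
  "zset Np cG = {fst cG + snd cG *v b | b. b \<in> unit_ball Np}"

definition in_An :: "(real^'n) \<times> (real^'p^'n) \<Rightarrow> bool" where
  "in_An cG \<longleftrightarrow> rank (snd cG) = CARD('n)"

definition Rh :: "real^'n^'n \<Rightarrow> (real^'n) set \<Rightarrow> real \<Rightarrow> (real^'n) set" where
  "Rh A X0 t = (\<lambda>x. mexp t A *v x) ` X0"

definition Ru :: "real^'n^'n \<Rightarrow> (real^'n) set \<Rightarrow> real \<Rightarrow> (real^'n) set" where
  "Ru A U t = {integral {0..t} (\<lambda>s. mexp s A *v w s) | w.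
                 w \<in> borel_measurable (lebesgue_on {0..t}) \<and> (\<forall>s\<in>{0..t}. w s \<in> U)}"

definition R :: "real^'n^'n \<Rightarrow> (real^'n) set \<Rightarrow> (real^'n) set \<Rightarrow> real \<Rightarrow> (real^'n) set" where
  "R A X0 U t = msum (Rh A X0 t) (Ru A U t)"

definition R_interval :: "real^'n^'n \<Rightarrow> (real^'n) set \<Rightarrow> (real^'n) set \<Rightarrow> real \<Rightarrow> (real^'n) set" where
  "R_interval A X0 U T = (\<Union>t\<in>{0..T}. R A X0 U t)"

definition in_I :: "real^'n^'n \<Rightarrow> real \<Rightarrow> bool" where
  "in_I A t \<longleftrightarrow> 0 \<le> t \<and> invertible (integral {0..t} (\<lambda>s. mexp s A))"

definition Lt :: "real^'n^'n \<Rightarrow> real \<Rightarrow> nat \<Rightarrow> real^'n^'n" where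
  "Lt A t k = (\<Sum>j<k. (t ^ j / fact j) *\<^sub>R mpow A j)"

definition Tt :: "real^'n^'n \<Rightarrow> real \<Rightarrow> nat \<Rightarrow> real^'n^'n" where
  "Tt A t k = (\<Sum>j<k. (t ^ (j + 1) / fact (j + 1)) *\<^sub>R mpow A j)"

definition theta :: "real \<Rightarrow> nat \<Rightarrow> real" where
  "theta r k = (\<Sum>j. r ^ (j + k) / fact (j + k))"

definition lam :: "(real^'n \<Rightarrow> real) \<Rightarrow> (real^'p \<Rightarrow> real) \<Rightarrow> real^'n^'n \<Rightarrow> real
                    \<Rightarrow> (real^'n) \<times> (real^'p^'n) \<Rightarrow> nat \<Rightarrow> real" where
  "lam Nn Np A t cG k =
     (let a = opnorm Nn Nn A; e = exp (t * a) * theta (t * a) k;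
          gi = opnorm Nn Np (pinv (snd cG)) in
      (1 - e * gi * Nn (fst cG)) / (1 + e * gi * opnorm Np Nn (snd cG)))"

definition kmin :: "real^'n^'n \<Rightarrow> real \<Rightarrow> nat" where
  "kmin A t = (LEAST k. theta (t * spectral_radius A) k * exp (t * spectral_radius A) < 1)"

definition kappa :: "(real^'n \<Rightarrow> real) \<Rightarrow> (real^'p \<Rightarrow> real) \<Rightarrow> real^'n^'n \<Rightarrow> real
                    \<Rightarrow> (real^'n) \<times> (real^'p^'n) \<Rightarrow> real \<Rightarrow> nat" where
  "kappa Nn Np A t cG \<epsilon> =
     (LEAST k. max (kmin A t) 2 \<le> k \<and> lam Nn Np A t cG k > \<epsilon>)"

definition eta :: "(real^'n \<Rightarrow> real) \<Rightarrow> (real^'p \<Rightarrow> real) \<Rightarrow> real^'n^'n \<Rightarrow> real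
                    \<Rightarrow> (real^'n) \<times> (real^'p^'n) \<Rightarrow> real \<Rightarrow> nat" where
  "eta Nn Np A t cG \<epsilon> =
     (LEAST k. lam Nn Np A t cG k > \<epsilon> \<and> invertible (Tt A t k))"

text \<open>The operators H and I, acting on representations (center, generator matrix).\<close>
definition Hop :: "(real^'n \<Rightarrow> real) \<Rightarrow> (real^'p \<Rightarrow> real) \<Rightarrow> real^'n^'n \<Rightarrow> real \<Rightarrow> real
                    \<Rightarrow> (real^'n) \<times> (real^'p^'n) \<Rightarrow> (real^'n) \<times> (real^'p^'n)" where
  "Hop Nn Np A t \<epsilon> cG =
     (let k = kappa Nn Np A t cG \<epsilon> in
      (Lt A t k *v fst cG, lam Nn Np A t cG k *\<^sub>R (Lt A t k ** snd cG)))"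

definition Iop :: "(real^'n \<Rightarrow> real) \<Rightarrow> (real^'p \<Rightarrow> real) \<Rightarrow> real^'n^'n \<Rightarrow> real \<Rightarrow> real
                    \<Rightarrow> (real^'n) \<times> (real^'p^'n) \<Rightarrow> (real^'n) \<times> (real^'p^'n)" where
  "Iop Nn Np A t \<epsilon> cG =
     (let k = eta Nn Np A t cG \<epsilon> in
      (Tt A t k *v fst cG, lam Nn Np A t cG k *\<^sub>R (Tt A t k ** snd cG)))"

primrec msum_iter :: "(nat \<Rightarrow> 'a::{zero,plus} set) \<Rightarrow> nat \<Rightarrow> 'a set" where
  "msum_iter F 0 = {0}"
| "msum_iter F (Suc i) = msum (msum_iter F i) (F i)"

end

theory Submission
  imports Defs "HOL-Computational_Algebra.Fundamental_Theorem_Algebra"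
begin

text \<open>Write \<open>L(s,k)\<close> for the truncated exponential. If \<open>x = c + \<lambda> G b\<close> with \<open>\<parallel>b\<parallel> \<le> 1\<close>,
  then \<open>exp(-sA) L(s,k) x\<close> differs from \<open>x\<close> by a vector \<open>y\<close> of norm at most
  \<open>exp(s\<parallel>A\<parallel>) \<theta>(s\<parallel>A\<parallel>,k) \<parallel>x\<parallel>\<close>. As \<open>G\<close> has full row rank, \<open>y\<close> can be absorbed into the
  generators by replacing \<open>\<lambda> b\<close> with \<open>\<lambda> b - G\<^sup>\<dagger> y\<close>, and \<open>\<lambda>\<close> is chosen so that the new
  coefficient stays in the unit ball. At \<open>s = t\<close> this puts \<open>L(t,k) x\<close> into the image under
  \<open>exp(tA)\<close>; over all \<open>s \<in> [0,t]\<close> it provides the continuous control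
  \<open>s \<mapsto> exp(-sA) L(s,k) x\<close>, which steers the system to \<open>T(t,k) x\<close>. To iterate, the new
  generator matrix must again have full rank: a singular \<open>L(t,k)\<close> would give an eigenvalue \<open>\<mu>\<close>
  of \<open>A\<close> with \<open>exp(t\<mu>)\<close> equal to its own Taylor remainder, which \<open>k \<ge> k\<^sub>m\<^sub>i\<^sub>n\<close> excludes. The
  exact recursion is \<open>R\<^sub>u(s+t) = R\<^sub>u(s) + exp(sA) R\<^sub>u(t)\<close>.\<close>

subsection \<open>Norms and the pseudoinverse\<close>

lemma is_norm_nonneg: "is_norm N \<Longrightarrow> 0 \<le> N x"
  and is_norm_eq_0: "is_norm N \<Longrightarrow> N x = 0 \<longleftrightarrow> x = 0"
  and is_norm_scaleR: "is_norm N \<Longrightarrow> N (a *\<^sub>R x) = \<bar>a\<bar> * N x"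
  and is_norm_triangle: "is_norm N \<Longrightarrow> N (x + y) \<le> N x + N y"
  by (auto simp: is_norm_def)

lemma is_norm_zero: "is_norm N \<Longrightarrow> N 0 = 0"
  by (simp add: is_norm_eq_0)

lemma is_norm_minus: "is_norm N \<Longrightarrow> N (- x) = N x"
  using is_norm_scaleR[of N "-1" x] by simp

lemma is_norm_diff: "is_norm N \<Longrightarrow> N (x - y) \<le> N x + N y"
  using is_norm_triangle[of N x "- y"] is_norm_minus[of N y] by simp

lemma is_norm_sum:
  assumes "is_norm N" "finite I"
  shows "N (\<Sum>i\<in>I. f i) \<le> (\<Sum>i\<in>I. N (f i))"
  using assms(2)
proof (induction I rule: finite_induct)
  case (insert i I)
  then show ?case using is_norm_triangle[OF assms(1), of "f i" "sum f I"] by simp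
qed (simp add: is_norm_zero[OF assms(1)])

text \<open>Expanding a vector in the standard basis bounds any norm by a multiple of the Euclidean
  one; the added 1 makes the constant visibly positive.\<close>

lemma is_norm_upper:
  fixes N :: "real^'n \<Rightarrow> real"
  assumes "is_norm N"
  obtains C where "C > 0" "\<And>x. N x \<le> C * norm x"
proof
  let ?C = "(\<Sum>i\<in>UNIV. N (axis i 1)) + 1"
  show "?C > 0"
    by (simp add: add_nonneg_pos sum_nonneg is_norm_nonneg[OF assms])
  fix x :: "real^'n"
  have "N x = N (\<Sum>i\<in>UNIV. (x$i) *\<^sub>R axis i 1)"
    using basis_expansion[of x] by (simp add: scalar_mult_eq_scaleR)
  also have "\<dots> \<le> (\<Sum>i\<in>UNIV. \<bar>x$i\<bar> * N (axis i 1))"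
    using is_norm_sum[OF assms, of UNIV "\<lambda>i. (x$i) *\<^sub>R axis i 1"] 
    by (simp add: is_norm_scaleR[OF assms])
  also have "\<dots> \<le> (\<Sum>i\<in>UNIV. norm x * N (axis i 1))"
    by (intro sum_mono mult_right_mono component_le_norm_cart is_norm_nonneg[OF assms])
  also have "\<dots> \<le> ?C * norm x"
    by (simp add: sum_distrib_left[symmetric] algebra_simps)
  finally show "N x \<le> ?C * norm x" .
qed

text \<open>The reverse triangle inequality and the upper bound make \<open>N\<close> Lipschitz for
  the Euclidean distance.\<close>

lemma continuous_on_is_norm:
  fixes N :: "real^'n \<Rightarrow> real"
  assumes "is_norm N"
  shows "continuous_on S N"
proof -
  obtain C where C: "C > 0" "\<And>x. N x \<le> C * norm x" using is_norm_upper[OF assms] by blast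
  have "C-lipschitz_on S N"
  proof (rule lipschitz_onI)
    fix x y
    have "N x - N y \<le> N (x - y)" "N y - N x \<le> N (x - y)"
      using is_norm_triangle[OF assms, of "x - y" y] is_norm_triangle[OF assms, of "y - x" x]
        is_norm_minus[OF assms, of "x - y"] by auto
    then show "dist (N x) (N y) \<le> C * dist x y"
      using C(2)[of "x - y"] by (simp add: dist_norm abs_le_iff)
  qed (use C in simp)
  then show ?thesis by (rule lipschitz_on_continuous_on)
qed

text \<open>The constant is the minimum of \<open>N\<close> on the compact Euclidean unit sphere,
  positive because \<open>N\<close> vanishes only at 0; homogeneity extends the bound to all
  vectors.\<close>

lemma is_norm_lower:
  fixes N :: "real^'n \<Rightarrow> real"
  assumes "is_norm N"
  obtains c where "c > 0" "\<And>x. c * norm x \<le> N x"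
proof -
  have "sphere (0::real^'n) 1 \<noteq> {}" by simp
  then obtain x0 where x0: "x0 \<in> sphere 0 1" "\<And>y. y \<in> sphere 0 1 \<Longrightarrow> N x0 \<le> N y"
    using continuous_attains_inf[OF compact_sphere _ continuous_on_is_norm[OF assms]] by metis
  show ?thesis
  proof
    show "N x0 > 0" using x0(1) is_norm_nonneg[OF assms, of x0] is_norm_eq_0[OF assms, of x0]
      by (auto simp: less_le)
    fix x :: "real^'n"
    show "N x0 * norm x \<le> N x"
    proof (cases "x = 0")
      case False
      then have "N x0 \<le> N ((1 / norm x) *\<^sub>R x)" by (intro x0(2)) simp
      then show ?thesis using False by (simp add: is_norm_scaleR[OF assms] field_simps)
    qed (simp add: is_norm_zero[OF assms])
  qed
qed

text \<open>The triangle inequality passes to the limit by continuity of \<open>N\<close>. Both the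
  bound on the exponential and the bound on its remainder come from here.\<close>

lemma is_norm_sums_le:
  fixes f :: "nat \<Rightarrow> real^'n"
  assumes N: "is_norm N" and f: "f sums s" and g: "g sums r" and le: "\<And>j. N (f j) \<le> g j"
  shows "N s \<le> r"
proof (rule LIMSEQ_le)
  have "isCont N s"
    using continuous_on_is_norm[OF N, of UNIV] by (simp add: continuous_on_eq_continuous_at)
  then show "(\<lambda>n. N (\<Sum>j<n. f j)) \<longlonglongrightarrow> N s"
    using f isCont_tendsto_compose unfolding sums_def by blast
  show "(\<lambda>n. \<Sum>j<n. g j) \<longlonglongrightarrow> r" using g by (simp add: sums_def)
  have "N (\<Sum>j<n. f j) \<le> (\<Sum>j<n. g j)" for n
    using is_norm_sum[OF N, of "{..<n}" f] sum_mono[of "{..<n}" "\<lambda>j. N (f j)" g] le by fastforce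
  then show "\<exists>n0. \<forall>n\<ge>n0. N (\<Sum>j<n. f j) \<le> (\<Sum>j<n. g j)" by blast
qed

lemma bounded_unit_ball:
  fixes N :: "real^'p \<Rightarrow> real"
  assumes "is_norm N"
  shows "bounded (unit_ball N)"
proof -
  obtain c where c: "c > 0" "\<And>x. c * norm x \<le> N x" using is_norm_lower[OF assms] by blast
  have "norm x \<le> 1 / c" if "x \<in> unit_ball N" for x
    using c(2)[of x] that c(1) by (simp add: unit_ball_def field_simps)
  then show ?thesis by (auto simp: bounded_iff)
qed

text \<open>\<open>opnorm\<close> is a real supremum, so its order properties become available only
  once the set is known to be bounded.\<close>

lemma opnorm_bdd_above:
  fixes Np :: "real^'p \<Rightarrow> real" and M :: "real^'p^'m"
  assumes p: "is_norm Np" and m: "is_norm Nm"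
  shows "bdd_above {Nm (M *v x) | x. Np x \<le> 1}"
proof -
  obtain B where B: "\<And>x. x \<in> unit_ball Np \<Longrightarrow> norm x \<le> B"
    using bounded_unit_ball[OF p] by (auto simp: bounded_iff)
  obtain C where C: "C > 0" "\<And>x. Nm x \<le> C * norm x" using is_norm_upper[OF m] by blast
  have "Nm (M *v x) \<le> C * (onorm ((*v) M) * B)" if "Np x \<le> 1" for x
  proof -
    have "norm (M *v x) \<le> onorm ((*v) M) * norm x"
      by (rule onorm) (rule matrix_vector_mul_bounded_linear)
    also have "\<dots> \<le> onorm ((*v) M) * B"
      using that by (intro mult_left_mono B onorm_pos_le matrix_vector_mul_bounded_linear)
        (simp add: unit_ball_def)
    finally show ?thesis using C by (meson order_trans mult_left_mono less_imp_le)
  qed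
  then show ?thesis by (auto simp: bdd_above_def)
qed

lemma opnorm_nonneg:
  fixes M :: "real^'p^'m"
  assumes p: "is_norm Np" and m: "is_norm Nm"
  shows "0 \<le> opnorm Np Nm M"
  unfolding opnorm_def
proof (rule cSup_upper2)
  show "Nm (M *v 0) \<in> {Nm (M *v x) | x. Np x \<le> 1}"
    using is_norm_zero[OF p] by fastforce
qed (auto intro: is_norm_nonneg[OF m] opnorm_bdd_above assms)

lemma opnorm_le:
  fixes M :: "real^'p^'m"
  assumes p: "is_norm Np" and m: "is_norm Nm"
  shows "Nm (M *v x) \<le> opnorm Np Nm M * Np x"
proof (cases "x = 0")
  case False
  then have pos: "Np x > 0"
    using is_norm_nonneg[OF p, of x] is_norm_eq_0[OF p, of x] by linarith
  have "Nm (M *v ((1 / Np x) *\<^sub>R x)) \<le> opnorm Np Nm M"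
    unfolding opnorm_def
    by (rule cSup_upper) (use pos in \<open>auto intro!: opnorm_bdd_above assms exI simp: is_norm_scaleR[OF p]\<close>)
  then show ?thesis
    using pos by (simp add: matrix_vector_mult_scaleR is_norm_scaleR[OF m] field_simps)
qed (simp add: is_norm_zero[OF p] is_norm_zero[OF m])

text \<open>Full row rank makes \<open>G ** transpose G\<close> invertible with inverse
  \<open>Y\<close>, and \<open>transpose G ** Y\<close> satisfies the four Penrose equations.
  Uniqueness has to be shown as well, since \<open>pinv\<close> is a definite description.\<close>

lemma pinv_right_inverse:
  fixes G :: "real^'p^'n"
  assumes rank: "rank G = CARD('n)"
  shows "G ** pinv G = mat 1"
proof -
  have "inj ((*v) (transpose G))"
    using rank by (simp add: full_rank_injective[symmetric] rank_transpose)
  have "x = 0" if "(G ** transpose G) *v x = 0" for x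
  proof -
    \<comment> \<open>A kernel vector of \<open>G ** transpose G\<close> has an image of length zero
      under \<open>transpose G\<close>, which is injective.\<close>
    have "inner (transpose G *v x) (transpose G *v x) = inner ((G ** transpose G) *v x) x"
      by (simp add: matrix_vector_mul_assoc[symmetric] dot_lmul_matrix[symmetric] inner_commute)
    then have "transpose G *v x = transpose G *v 0" using that by simp
    then show "x = 0" using \<open>inj ((*v) (transpose G))\<close> by (blast dest: injD)
  qed
  then obtain Y where "Y ** (G ** transpose G) = mat 1"
    using matrix_left_invertible_ker by blast
  then have Y: "(G ** transpose G) ** Y = mat 1" "Y ** (G ** transpose G) = mat 1"
    by (simp_all add: matrix_left_right_inverse)
  have tY: "transpose Y = Y"
  proof -
    have *: "transpose Y ** (G ** transpose G) = mat 1"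
      using arg_cong[OF Y(1), of transpose] by (simp add: matrix_transpose_mul)
    have "transpose Y = transpose Y ** ((G ** transpose G) ** Y)" using Y by simp
    also have "\<dots> = Y" using * by (simp add: matrix_mul_assoc[of "transpose Y"])
    finally show ?thesis .
  qed
  define X where "X = transpose G ** Y"
  define P where "P = (\<lambda>X. G ** X ** G = G \<and> X ** G ** X = X
               \<and> transpose (G ** X) = G ** X \<and> transpose (X ** G) = X ** G)"
  have GX: "G ** X = mat 1" using Y by (simp add: X_def matrix_mul_assoc)
  have "P X"
    unfolding P_def
  proof (intro conjI)
    show "X ** G ** X = X" using GX by (simp add: matrix_mul_assoc[symmetric])
    show "transpose (X ** G) = X ** G"
      by (simp add: X_def matrix_transpose_mul tY matrix_mul_assoc)
  qed (simp_all add: GX)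
  moreover have "Z = X" if "P Z" for Z
  proof -
    have Z: "G ** Z ** G = G" "transpose (Z ** G) = Z ** G"
      using that by (auto simp: P_def)
    have GZ: "G ** Z = mat 1"
      using arg_cong[OF Z(1), of "\<lambda>M. M ** X"] GX by (simp add: matrix_mul_assoc[symmetric])
    \<comment> \<open>\<open>X ** G\<close> and \<open>Z ** G\<close> are symmetric, so transposing
      \<open>(X ** G) ** (Z ** G) = X ** G\<close> swaps the factors; the swapped product also
      equals \<open>Z ** G\<close>.\<close>
    have "X ** G = (Z ** G) ** (X ** G)"
    proof -
      have "(X ** G) ** (Z ** G) = X ** G"
        by (metis GZ matrix_mul_assoc matrix_mul_rid)
      then have "transpose (Z ** G) ** transpose (X ** G) = transpose (X ** G)"
        by (metis matrix_transpose_mul)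
      then show ?thesis using Z \<open>P X\<close> by (simp add: P_def)
    qed
    also have "\<dots> = Z ** G" by (metis GX matrix_mul_assoc matrix_mul_rid)
    finally have "X ** G ** X = Z ** G ** X" by simp
    then show "Z = X" using GX by (simp add: matrix_mul_assoc[symmetric])
  qed
  ultimately have "pinv G = X" unfolding pinv_def P_def by (rule the_equality)
  then show ?thesis using GX by simp
qed

subsection \<open>The matrix exponential\<close>

lemma bounded_bilinear_matrix_mult:
  "bounded_bilinear ((**) :: real^'n^'m \<Rightarrow> real^'p^'n \<Rightarrow> real^'p^'m)"
  unfolding bilinear_conv_bounded_bilinear[symmetric] bilinear_def
  by (auto intro!: linearI simp: vec_eq_iff matrix_matrix_mult_def sum_distrib_left sum.distrib
      distrib_left distrib_right mult_ac)

lemma bounded_bilinear_matrix_vector_mult: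
  "bounded_bilinear ((*v) :: real^'n^'m \<Rightarrow> real^'n \<Rightarrow> real^'m)"
  unfolding bilinear_conv_bounded_bilinear[symmetric] bilinear_def
  by (auto intro!: linearI simp: matrix_vector_right_distrib matrix_vector_mult_add_rdistrib
      matrix_vector_mult_scaleR scaleR_matrix_vector_assoc[symmetric])

text \<open>Bilinearity bounds the Euclidean norm of a product by the product of the norms up to a
  constant; this constant is absorbed into the base of the geometric bound.\<close>

lemma norm_mpow_le:
  fixes A :: "real^'n^'n"
  obtains K where "K \<ge> 0" "\<And>j. norm (mpow A j) \<le> norm (mat 1 :: real^'n^'n) * K ^ j"
proof -
  interpret mm: bounded_bilinear "(**) :: real^'n^'n \<Rightarrow> real^'n^'n \<Rightarrow> real^'n^'n"
    by (rule bounded_bilinear_matrix_mult)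
  obtain K where K: "K > 0" "\<And>(X :: real^'n^'n) (Y :: real^'n^'n). norm (X ** Y) \<le> norm X * norm Y * K"
    using mm.pos_bounded by blast
  have "norm (mpow A j) \<le> norm (mat 1 :: real^'n^'n) * (norm A * K) ^ j" for j
  proof (induction j)
    case (Suc j)
    have "norm (mpow A (Suc j)) \<le> (norm A * K) * norm (mpow A j)"
      using K(2)[of A "mpow A j"] by (simp add: algebra_simps)
    also have "\<dots> \<le> (norm A * K) * (norm (mat 1 :: real^'n^'n) * (norm A * K) ^ j)"
      using Suc K(1) by (intro mult_left_mono) auto
    finally show ?case by (simp add: algebra_simps)
  qed simp
  moreover have "norm A * K \<ge> 0" using K by simp
  ultimately show ?thesis using that by blast
qed

lemma mpow_commute: "mpow A k ** A = A ** mpow A k"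
  by (induction k) (simp_all add: matrix_mul_assoc[symmetric])

lemma summable_mexp:
  fixes A :: "real^'n^'n"
  shows "summable (\<lambda>j. norm ((t ^ j / fact j) *\<^sub>R mpow A j))"
proof -
  obtain K where K: "K \<ge> 0" "\<And>j. norm (mpow A j) \<le> norm (mat 1 :: real^'n^'n) * K ^ j"
    using norm_mpow_le by blast
  let ?c = "norm (mat 1 :: real^'n^'n)"
  show ?thesis
  proof (rule summable_comparison_test')
    show "summable (\<lambda>j. ?c * (inverse (fact j) * (\<bar>t\<bar> * K) ^ j))"
      by (intro summable_mult summable_exp)
    show "norm (norm ((t ^ j / fact j) *\<^sub>R mpow A j)) \<le> ?c * (inverse (fact j) * (\<bar>t\<bar> * K) ^ j)" for j
      using mult_left_mono[OF K(2)[of j], of "\<bar>t\<bar> ^ j / fact j"]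
      by (simp add: power_abs power_mult_distrib field_simps)
  qed
qed

lemma mexp_sums: "(\<lambda>j. (t ^ j / fact j) *\<^sub>R mpow A j) sums mexp t A"
  for A :: "real^'n^'n"
  unfolding mexp_def by (rule summable_sums, rule summable_norm_cancel, rule summable_mexp)

lemma mexp_nth_sums: "(\<lambda>k. (mpow A k $ i $ j / fact k) * t ^ k) sums (mexp t A $ i $ j)"
  for A :: "real^'n^'n"
  using bounded_linear.sums[OF bounded_linear_vec_nth bounded_linear.sums[OF bounded_linear_vec_nth mexp_sums]]
  by (simp add: field_simps)

lemma mexp_mult_sums: "(\<lambda>k. (t ^ k / fact k) *\<^sub>R (mpow A k *v x)) sums (mexp t A *v x)"
  for A :: "real^'n^'n"
  using bounded_linear.sums[OF bounded_bilinear.bounded_linear_left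
      [OF bounded_bilinear_matrix_vector_mult, of x] mexp_sums[of t A]]
  by (simp add: scaleR_matrix_vector_assoc)

lemma mexp_commute: "mexp t A ** A = A ** mexp t A"
  for A :: "real^'n^'n"
proof (rule sums_unique2)
  show "(\<lambda>j. (t ^ j / fact j) *\<^sub>R (A ** mpow A j)) sums (A ** mexp t A)"
    using bounded_linear.sums[OF bounded_bilinear.bounded_linear_right
      [OF bounded_bilinear_matrix_mult, of A] mexp_sums[of t A]]
    by (simp add: bounded_bilinear.scaleR_right[OF bounded_bilinear_matrix_mult])
  show "(\<lambda>j. (t ^ j / fact j) *\<^sub>R (A ** mpow A j)) sums (mexp t A ** A)"
    using bounded_linear.sums[OF bounded_bilinear.bounded_linear_left
      [OF bounded_bilinear_matrix_mult, of A] mexp_sums[of t A]]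
    by (simp add: bounded_bilinear.scaleR_left[OF bounded_bilinear_matrix_mult] mpow_commute)
qed

text \<open>Each entry is an everywhere convergent scalar power series, so it may be differentiated
  termwise. The shifted coefficients contain \<open>mpow A (Suc k)\<close>, from which one factor
  \<open>A\<close> splits off.\<close>

lemma mexp_nth_deriv:
  fixes A :: "real^'n^'n"
  shows "((\<lambda>t. mexp t A $ i $ j) has_field_derivative (A ** mexp t A) $ i $ j) (at t)"
proof -
  let ?c = "\<lambda>k. mpow A k $ i $ j / fact k"
  have eq: "mexp s A $ i $ j = (\<Sum>k. ?c k * s ^ k)" for s
    using mexp_nth_sums by (rule sums_unique)
  have "diffs ?c k = (\<Sum>l\<in>UNIV. A $ i $ l * (mpow A k $ l $ j / fact k))" for k
  proof -
    have "diffs ?c k = mpow A (Suc k) $ i $ j / fact k"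
      by (simp add: diffs_def del: mpow.simps of_nat_Suc)
    then show ?thesis by (simp add: matrix_matrix_mult_def sum_divide_distrib)
  qed
  then have "(\<lambda>k. diffs ?c k * t ^ k) = (\<lambda>k. \<Sum>l\<in>UNIV. A $ i $ l * ((mpow A k $ l $ j / fact k) * t ^ k))"
    by (simp add: sum_distrib_right mult.assoc)
  moreover have "\<dots> sums (\<Sum>l\<in>UNIV. A $ i $ l * mexp t A $ l $ j)"
    by (intro sums_sum sums_mult mexp_nth_sums)
  ultimately have "(\<Sum>k. diffs ?c k * t ^ k) = (A ** mexp t A) $ i $ j"
    by (simp add: sums_iff matrix_matrix_mult_def)
  moreover have "((\<lambda>s. \<Sum>k. ?c k * s ^ k) has_field_derivative (\<Sum>k. diffs ?c k * t ^ k)) (at t)"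
    by (rule termdiffs_strong_converges_everywhere) (rule sums_summable[OF mexp_nth_sums])
  ultimately show ?thesis by (simp add: eq)
qed

lemma mexp_0: "mexp 0 A = mat 1" for A :: "real^'n^'n"
proof -
  have "(\<lambda>j. (0 ^ j / fact j) *\<^sub>R mpow A j) sums (\<Sum>j\<in>{0}. (0 ^ j / fact j) *\<^sub>R mpow A j)"
    by (rule sums_finite) auto
  then show ?thesis using mexp_sums[of 0 A] by (simp add: sums_iff)
qed

text \<open>The left side has derivative 0 in \<open>s\<close>, because \<open>A\<close> commutes
  with its exponential, so it equals its value at \<open>s = 0\<close>. Inverses and the semigroup
  law both follow from this identity.\<close>

lemma mexp_minus_mult_mexp_add: "mexp (- s) A ** mexp (s + t) A = mexp t A"
  for A :: "real^'n^'n"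
proof -
  have "(mexp (- s) A ** mexp (s + t) A) $ i $ j = (mexp (- 0) A ** mexp (0 + t) A) $ i $ j" for i j
  proof (rule DERIV_isconst_all[where f = "\<lambda>s. (mexp (- s) A ** mexp (s + t) A) $ i $ j"], rule allI)
    fix s
    let ?E = "mexp (- s) A" and ?F = "mexp (s + t) A"
    have 1: "((\<lambda>s. mexp (- s) A $ i $ l) has_field_derivative - (A ** ?E) $ i $ l) (at s)" for l
      using DERIV_chain'[of uminus "-1" s UNIV, OF _ mexp_nth_deriv[of A i l "- s"]]
      by (simp add: DERIV_minus)
    have 2: "((\<lambda>s. mexp (s + t) A $ l $ j) has_field_derivative (A ** ?F) $ l $ j) (at s)" for l
      using mexp_nth_deriv[of A l j "s + t"] by (simp add: DERIV_shift)
    have "((\<lambda>s. (mexp (- s) A ** mexp (s + t) A) $ i $ j) has_field_derivative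
        (\<Sum>l\<in>UNIV. - (A ** ?E) $ i $ l * ?F $ l $ j + (A ** ?F) $ l $ j * ?E $ i $ l)) (at s)"
      unfolding matrix_matrix_mult_def vec_lambda_beta
      by (intro DERIV_sum DERIV_mult[OF 1[unfolded matrix_matrix_mult_def vec_lambda_beta]
            2[unfolded matrix_matrix_mult_def vec_lambda_beta]])
    moreover have "(\<Sum>l\<in>UNIV. - (A ** ?E) $ i $ l * ?F $ l $ j + (A ** ?F) $ l $ j * ?E $ i $ l)
        = (?E ** (A ** ?F)) $ i $ j - ((A ** ?E) ** ?F) $ i $ j"
      by (simp add: matrix_matrix_mult_def[of ?E] matrix_matrix_mult_def[of "A ** ?E"]
          sum_subtractf[symmetric] algebra_simps)
    moreover have "?E ** (A ** ?F) = (A ** ?E) ** ?F"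
      by (simp add: matrix_mul_assoc mexp_commute)
    ultimately show "((\<lambda>s. (mexp (- s) A ** mexp (s + t) A) $ i $ j) has_field_derivative 0) (at s)"
      by simp
  qed
  then show ?thesis by (simp add: vec_eq_iff mexp_0)
qed

lemma mexp_minus_mult: "mexp (- s) A ** mexp s A = mat 1" for A :: "real^'n^'n"
  using mexp_minus_mult_mexp_add[of s A 0] by (simp add: mexp_0)

lemma mexp_mult_minus: "mexp s A ** mexp (- s) A = mat 1" for A :: "real^'n^'n"
  using mexp_minus_mult[of "- s" A] by simp

lemma mexp_add: "mexp (s + t) A = mexp s A ** mexp t A" for A :: "real^'n^'n"
proof -
  have "mexp s A ** mexp t A = mexp s A ** (mexp (- s) A ** mexp (s + t) A)"
    by (simp add: mexp_minus_mult_mexp_add)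
  then show ?thesis by (simp add: matrix_mul_assoc mexp_mult_minus)
qed

lemma continuous_on_mexp: "continuous_on S (\<lambda>t. mexp t A)" for A :: "real^'n^'n"
proof -
  have "continuous_on S (\<lambda>t. \<chi> i j. mexp t A $ i $ j)"
    by (intro continuous_on_vec_lambda continuous_at_imp_continuous_on ballI DERIV_isCont[OF mexp_nth_deriv])
  then show ?thesis by simp
qed

section \<open>Integrals of the exponential and of its truncations\<close>

lemma Lt_has_integral:
  fixes A :: "real^'n^'n"
  assumes "0 \<le> t"
  shows "((\<lambda>s. Lt A s k) has_integral Tt A t k) {0..t}"
proof -
  have "((\<lambda>s. (s ^ j / fact j) *\<^sub>R mpow A j) has_integral (t ^ (j + 1) / fact (j + 1)) *\<^sub>R mpow A j) {0..t}" for j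
  proof -
    have "((\<lambda>s. s ^ (j + 1) / fact (j + 1)) has_real_derivative s ^ j / fact j) (at s within {0..t})" for s
      using DERIV_subset[OF DERIV_cdivide[OF DERIV_pow[of "Suc j" s UNIV], of "fact (Suc j)"]]
      by (simp del: of_nat_Suc)
    then have "((\<lambda>s::real. s ^ j / fact j) has_integral (t ^ (j + 1) / fact (j + 1) - 0 ^ (j + 1) / fact (j + 1))) {0..t}"
      using assms
      by (intro fundamental_theorem_of_calculus)
        (auto simp: has_real_derivative_iff_has_vector_derivative[symmetric])
    then show ?thesis by (intro has_integral_scaleR_left) simp
  qed
  then show ?thesis unfolding Lt_def Tt_def by (intro has_integral_sum) auto
qed

text \<open>The exponential series converges uniformly on \<open>{0..t}\<close>, so integration and
  limit may be exchanged. This links the condition \<open>in_I\<close> to invertibility of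
  \<open>Tt A t k\<close> for large \<open>k\<close>.\<close>

lemma Tt_tendsto:
  fixes A :: "real^'n^'n"
  assumes "0 \<le> t"
  shows "(\<lambda>k. Tt A t k) \<longlonglongrightarrow> integral {0..t} (\<lambda>s. mexp s A)"
proof -
  have "uniform_limit {0..t} (\<lambda>k s. \<Sum>j<k. (s ^ j / fact j) *\<^sub>R mpow A j)
      (\<lambda>s. \<Sum>j. (s ^ j / fact j) *\<^sub>R mpow A j) sequentially"
  proof (rule Weierstrass_m_test)
    \<comment> \<open>The majorant is the term at the right endpoint \<open>t\<close>.\<close>
    show "norm ((s ^ j / fact j) *\<^sub>R mpow A j) \<le> norm ((t ^ j / fact j) *\<^sub>R mpow A j)"
      if "s \<in> {0..t}" for j s
      using that by (auto intro!: mult_right_mono divide_right_mono power_mono)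
  qed (rule summable_mexp)
  then have u: "uniform_limit (cbox 0 t) (\<lambda>k s. Lt A s k) (\<lambda>s. mexp s A) sequentially"
    by (simp add: Lt_def mexp_def)
  have c: "continuous_on (cbox 0 t) (\<lambda>s. Lt A s k)" for k
    unfolding Lt_def by (intro continuous_intros) auto
  obtain I J where I: "\<And>k. ((\<lambda>s. Lt A s k) has_integral I k) (cbox 0 t)"
      and J: "((\<lambda>s. mexp s A) has_integral J) (cbox 0 t)" and lim: "I \<longlonglongrightarrow> J"
    using uniform_limit_integral_cbox[OF u c sequentially_bot] by blast
  have "I = (\<lambda>k. Tt A t k)"
    using I Lt_has_integral[OF assms] by (intro ext) (auto intro: has_integral_unique)
  then show ?thesis using J lim by (simp add: integral_unique)
qed

subsection \<open>Spectral radius and the truncated exponential\<close>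

text \<open>The spectral radius is taken over complex eigenvalues, so real matrices and vectors are
  embedded into complex ones.\<close>

definition cmat :: "real^'n^'m \<Rightarrow> complex^'n^'m" where
  "cmat A = (\<chi> i j. complex_of_real (A $ i $ j))"

definition cvec :: "real^'n \<Rightarrow> complex^'n" where
  "cvec x = (\<chi> i. complex_of_real (x $ i))"

lemma cmat_mult: "cmat (A ** B) = cmat A ** cmat B"
  by (simp add: vec_eq_iff cmat_def matrix_matrix_mult_def)

lemma cmat_mat_1: "cmat (mat 1) = mat 1"
  by (simp add: vec_eq_iff cmat_def mat_def)

lemma cmat_add: "cmat (A + B) = cmat A + cmat B"
  by (simp add: vec_eq_iff cmat_def)

lemma cmat_scaleR_mult_vec: "cmat (c *\<^sub>R A) *v v = of_real c *s (cmat A *v v)"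
  by (simp add: vec_eq_iff cmat_def matrix_vector_mult_def sum_distrib_left mult.assoc)

lemma cmat_mult_cvec: "cmat A *v cvec x = cvec (A *v x)"
  by (simp add: vec_eq_iff cmat_def cvec_def matrix_vector_mult_def)

text \<open>Horner's scheme for the vector \<open>p(M) v\<close>, which avoids forming the matrix
  \<open>p(M)\<close>.\<close>

definition poly_mat_vec :: "complex poly \<Rightarrow> complex^'n^'n \<Rightarrow> complex^'n \<Rightarrow> complex^'n" where
  "poly_mat_vec p M v = fold_coeffs (\<lambda>a w. a *s v + M *v w) p 0"

lemma poly_mat_vec_0 [simp]: "poly_mat_vec 0 M v = 0"
  by (simp add: poly_mat_vec_def)

lemma poly_mat_vec_pCons [simp]: "poly_mat_vec (pCons a p) M v = a *s v + M *v poly_mat_vec p M v"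
  by (cases "a = 0 \<and> p = 0") (auto simp: poly_mat_vec_def)

lemma poly_mat_vec_add: "poly_mat_vec (p + q) M v = poly_mat_vec p M v + poly_mat_vec q M v"
  by (induction p q rule: poly_induct2)
    (simp_all add: matrix_vector_right_distrib vector_sadd_rdistrib)

lemma poly_mat_vec_smult: "poly_mat_vec (smult c p) M v = c *s poly_mat_vec p M v"
  by (induction p) (simp_all add: vector_add_ldistrib vector_smult_assoc vector_scalar_commute)

lemma poly_mat_vec_eigenvector:
  assumes "M *v v = l *s v"
  shows "poly_mat_vec p M v = poly p l *s v"
  by (induction p)
    (simp_all add: assms vector_scalar_commute vector_smult_assoc vector_sadd_rdistrib mult.commute)

text \<open>Splitting off linear factors one by one: the last nonzero vector before the product
  annihilates \<^term>\<open>v\<close> is an eigenvector.\<close>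

lemma poly_mat_vec_eq_0_imp_eigenvalue:
  fixes M :: "complex^'n^'n"
  assumes "p \<noteq> 0" "v \<noteq> 0" "poly_mat_vec p M v = 0"
  shows "\<exists>l w. w \<noteq> 0 \<and> M *v w = l *s w \<and> poly p l = 0"
  using assms
proof (induction "degree p" arbitrary: p)
  case 0
  then obtain a where "p = [:a:]" by (metis degree_0_id)
  then show ?case using 0 by (simp add: vector_mul_eq_0)
next
  case (Suc n)
  then have "\<not> constant (poly p)" by (simp add: constant_degree)
  then obtain l where l: "poly p l = 0" using fundamental_theorem_of_algebra by blast
  then obtain q where q: "p = [:- l, 1:] * q" by (metis dvdE poly_eq_0_iff_dvd)
  then have "q \<noteq> 0" using Suc.prems(1) by auto
  then have deg: "n = degree q" using Suc.hyps(2) by (simp add: q degree_mult_eq del: mult_pCons_left)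
  have "poly_mat_vec p M v = M *v poly_mat_vec q M v - l *s poly_mat_vec q M v"
  proof -
    have "p = pCons 0 q + smult (- l) q" by (simp add: q)
    then have "poly_mat_vec p M v = M *v poly_mat_vec q M v + (- l) *s poly_mat_vec q M v"
      by (simp only: poly_mat_vec_add poly_mat_vec_smult poly_mat_vec_pCons vector_smult_lzero add_0)
    then show ?thesis by (simp add: vec_eq_iff)
  qed
  then have "M *v poly_mat_vec q M v = l *s poly_mat_vec q M v"
    using Suc.prems(3) by simp
  then show ?case
    using l q Suc.hyps(1)[OF deg \<open>q \<noteq> 0\<close> Suc.prems(2)] by (cases "poly_mat_vec q M v = 0") auto
qed

lemma poly_mat_vec_monom:
  "poly_mat_vec (monom (of_real c) j) (cmat A) v = cmat (c *\<^sub>R mpow A j) *v v"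
proof (induction j)
  case (Suc j)
  then show ?case
    by (simp add: monom_Suc cmat_scaleR_mult_vec cmat_mult matrix_vector_mul_assoc[symmetric]
        vector_scalar_commute)
qed (simp add: monom_0 cmat_scaleR_mult_vec cmat_mat_1)

lemma poly_mat_vec_sum_monom:
  assumes "finite J"
  shows "poly_mat_vec (\<Sum>j\<in>J. monom (of_real (c j)) j) (cmat A) v = cmat (\<Sum>j\<in>J. c j *\<^sub>R mpow A j) *v v"
  using assms
proof (induction J rule: finite_induct)
  case empty
  then show ?case by (simp add: vec_eq_iff cmat_def matrix_vector_mult_def)
qed (simp add: poly_mat_vec_add poly_mat_vec_monom cmat_add matrix_vector_mult_add_rdistrib)

lemma sum_monom_neq_0:
  assumes "finite J" "j \<in> J" "c j \<noteq> (0::real)"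
  shows "(\<Sum>j\<in>J. monom (complex_of_real (c j)) j) \<noteq> 0"
proof -
  have "coeff (\<Sum>j\<in>J. monom (complex_of_real (c j)) j) j = of_real (c j)"
    using assms by (simp add: coeff_sum)
  then show ?thesis using assms(3) by (metis coeff_0 of_real_eq_0_iff)
qed

text \<open>Counting dimensions: \<open>d + 1\<close> powers of \<open>A\<close> cannot be
  independent in a space of dimension \<open>d\<close>. This yields a nonzero polynomial
  annihilating \<open>A\<close>.\<close>

lemma mpow_dependent:
  fixes A :: "real^'n^'n"
  obtains j d c where "j \<le> d" "c j \<noteq> 0" "(\<Sum>i\<le>d. c i *\<^sub>R mpow A i) = 0"
proof -
  define d where "d = DIM(real^'n^'n)"
  show ?thesis
  proof (cases "inj_on (mpow A) {..d}")
    case True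
    then have "card (mpow A ` {..d}) = Suc d" by (simp add: card_image)
    then have "dependent (mpow A ` {..d})"
      by (intro dependent_biggerset_general) (simp only: d_def le_imp_less_Suc dim_subset_UNIV)
    then obtain u where u: "\<exists>v\<in>mpow A ` {..d}. u v \<noteq> 0" "(\<Sum>v\<in>mpow A ` {..d}. u v *\<^sub>R v) = 0"
      by (auto simp: dependent_finite)
    then have "(\<Sum>i\<le>d. u (mpow A i) *\<^sub>R mpow A i) = 0"
      by (simp add: sum.reindex[OF True])
    then show ?thesis using u(1) that[of _ d "\<lambda>i. u (mpow A i)"] by (metis (no_types, lifting) atMost_iff imageE)
  next
    \<comment> \<open>If two powers coincide, the set of powers is too small for the dimension
      count, but their difference is already a nontrivial relation.\<close>
    case False
    then obtain i j where ij: "i \<le> d" "j \<le> d" "i \<noteq> j" "mpow A i = mpow A j"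
      by (auto simp: inj_on_def)
    define c where "c = (\<lambda>k. if k = i then 1 else if k = j then - 1 else (0::real))"
    have "(\<Sum>k\<le>d. c k *\<^sub>R mpow A k) = (\<Sum>k\<in>{i, j}. c k *\<^sub>R mpow A k)"
      using ij by (intro sum.mono_neutral_right) (auto simp: c_def)
    also have "\<dots> = 0" using ij by (simp add: c_def)
    finally show ?thesis using ij by (intro that[of i d c]) (auto simp: c_def)
  qed
qed

text \<open>\<open>Max\<close> bounds its elements only for finite sets. Finiteness holds since
  every eigenvalue is a root of one nonzero polynomial that annihilates \<open>A\<close>.\<close>

lemma cmod_le_spectral_radius:
  fixes A :: "real^'n^'n"
  assumes "v \<noteq> 0" "cmat A *v v = l *s v"
  shows "cmod l \<le> spectral_radius A"
proof -
  obtain j d c where dc: "j \<le> d" "c j \<noteq> 0" "(\<Sum>i\<le>d. c i *\<^sub>R mpow A i) = 0"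
    by (rule mpow_dependent[of A])
  define p where "p = (\<Sum>i\<le>d. monom (complex_of_real (c i)) i)"
  have "p \<noteq> 0" unfolding p_def using dc by (intro sum_monom_neq_0[of _ j]) auto
  have "poly p m = 0" if "w \<noteq> 0" "cmat A *v w = m *s w" for m w
  proof -
    have "poly p m *s w = poly_mat_vec p (cmat A) w"
      using that by (simp add: poly_mat_vec_eigenvector)
    also have "\<dots> = cmat (\<Sum>i\<le>d. c i *\<^sub>R mpow A i) *v w"
      unfolding p_def by (rule poly_mat_vec_sum_monom) simp
    also have "\<dots> = 0" by (simp add: dc(3) vec_eq_iff cmat_def matrix_vector_mult_def)
    finally show ?thesis using that by (simp add: vector_mul_eq_0)
  qed
  then have "{cmod l | l. \<exists>v. v \<noteq> 0 \<and> cmat A *v v = l *s v} \<subseteq> cmod ` {m. poly p m = 0}"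
    by auto
  then have "finite {cmod l | l. \<exists>v. v \<noteq> 0 \<and> cmat A *v v = l *s v}"
    by (rule finite_subset) (simp add: poly_roots_finite \<open>p \<noteq> 0\<close>)
  then show ?thesis
    unfolding spectral_radius_def cmat_def[symmetric] using assms by (intro Max_ge) auto
qed

section \<open>Remainders of the exponential series and invertibility of the truncation\<close>

lemma theta_summable: "summable (\<lambda>j. r ^ (j + k) / fact (j + k))" for r :: real
  using summable_ignore_initial_segment[OF summable_exp[of r], of k] by (simp add: field_simps)

lemma theta_nonneg: "0 \<le> r \<Longrightarrow> 0 \<le> theta r k"
  unfolding theta_def by (intro suminf_nonneg theta_summable) auto

lemma theta_Suc: "theta r k = r ^ k / fact k + theta r (Suc k)"
  unfolding theta_def using suminf_split_head[OF theta_summable[of r k]] by simp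

lemma theta_antimono:
  assumes "0 \<le> r" "k \<le> l"
  shows "theta r l \<le> theta r k"
  using assms(2)
proof (induction rule: dec_induct)
  case (step n)
  have "theta r (Suc n) \<le> theta r n" using theta_Suc[of r n] assms(1) by simp
  with step show ?case by linarith
qed simp

lemma theta_eq_exp_minus: "theta r k = exp r - (\<Sum>j<k. r ^ j / fact j)"
  unfolding theta_def exp_def
  using suminf_minus_initial_segment[OF summable_exp[of r], of k] by (simp add: field_simps)

lemma theta_tendsto_0: "theta r \<longlonglongrightarrow> 0"
proof -
  have "(\<lambda>k. \<Sum>j<k. r ^ j / fact j) \<longlonglongrightarrow> exp r"
    using exp_converges[of r] by (simp add: sums_def field_simps)
  then have "(\<lambda>k. exp r - (\<Sum>j<k. r ^ j / fact j)) \<longlonglongrightarrow> exp r - exp r"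
    by (intro tendsto_diff tendsto_const)
  then show ?thesis by (simp add: theta_eq_exp_minus[abs_def])
qed

lemma theta_mono:
  assumes "0 \<le> r" "r \<le> s"
  shows "theta r k \<le> theta s k"
  unfolding theta_def
  using assms by (intro suminf_le theta_summable divide_right_mono power_mono) auto

lemma invertible_Lt:
  fixes A :: "real^'n^'n"
  assumes t: "0 \<le> t" and k: "kmin A t \<le> k" "0 < k"
  shows "invertible (Lt A t k)"
proof (rule ccontr)
  assume "\<not> invertible (Lt A t k)"
  then obtain x where x: "Lt A t k *v x = 0" "x \<noteq> 0"
    by (metis invertible_left_inverse matrix_left_invertible_ker)
  define p where "p = (\<Sum>j<k. monom (complex_of_real (t ^ j / fact j)) j)"
  \<comment> \<open>The constant coefficient is 1, also for \<open>t = 0\<close>; it is present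
    because \<open>0 < k\<close>.\<close>
  have "p \<noteq> 0" unfolding p_def using k by (intro sum_monom_neq_0[of _ 0]) auto
  moreover have "poly_mat_vec p (cmat A) (cvec x) = 0"
    unfolding p_def poly_mat_vec_sum_monom[OF finite_lessThan] Lt_def[symmetric]
    by (simp add: cmat_mult_cvec x(1)) (simp add: cvec_def vec_eq_iff)
  moreover have "cvec x \<noteq> 0" using x(2) by (auto simp: cvec_def vec_eq_iff)
  ultimately obtain l w where w: "w \<noteq> 0" "cmat A *v w = l *s w" and l: "poly p l = 0"
    using poly_mat_vec_eq_0_imp_eigenvalue by blast
  define r where "r = t * spectral_radius A"
  define z where "z = of_real t * l"
  have "cmod l \<le> spectral_radius A" using cmod_le_spectral_radius[OF w] .
  then have z: "cmod z \<le> r" using t by (simp add: z_def r_def norm_mult mult_left_mono)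
  then have r: "0 \<le> r" using norm_ge_zero order_trans by blast
  have Lz: "(\<Sum>j<k. z ^ j /\<^sub>R fact j) = 0"
    using l by (simp add: p_def poly_sum poly_monom z_def power_mult_distrib scaleR_conv_of_real field_simps)
  have s: "summable (\<lambda>j. norm (z ^ (j + k) /\<^sub>R fact (j + k)))"
    using summable_ignore_initial_segment[OF summable_norm_exp[of z], of k] by simp
  \<comment> \<open>The truncated series vanishes at \<open>z\<close>, so only the remainder is
    left.\<close>
  have "exp z = (\<Sum>j. z ^ (j + k) /\<^sub>R fact (j + k))"
    using suminf_minus_initial_segment[OF summable_exp_generic[of z], of k] Lz by (simp add: exp_def)
  then have "cmod (exp z) \<le> (\<Sum>j. norm (z ^ (j + k) /\<^sub>R fact (j + k)))"
    using summable_norm[OF s] by simp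
  also have "\<dots> = theta (cmod z) k"
    by (simp add: theta_def norm_power norm_divide divide_inverse mult.commute)
  also have "\<dots> \<le> theta r k" using z by (intro theta_mono) auto
  also have "\<dots> \<le> theta r (kmin A t)" using r k by (intro theta_antimono) auto
  finally have 1: "exp (Re z) \<le> theta r (kmin A t)" by simp
  \<comment> \<open>A witness is required before the least such index, \<open>kmin\<close>, can be
    said to satisfy the inequality.\<close>
  have "\<exists>k. theta r k * exp r < 1"
  proof -
    have "(\<lambda>k. theta r k * exp r) \<longlonglongrightarrow> 0"
      using tendsto_mult_right[OF theta_tendsto_0[of r], of "exp r"] by simp
    then have "eventually (\<lambda>k. theta r k * exp r < 1) sequentially"
      by (rule order_tendstoD) simp
    then show ?thesis by (rule eventually_happens'[OF sequentially_bot])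
  qed
  then have "theta r (kmin A t) * exp r < 1"
    unfolding kmin_def r_def by (rule LeastI_ex)
  with 1 have "exp (Re z) * exp r < 1" by (smt (verit) exp_gt_zero mult_right_mono)
  then have "exp (Re z + r) < 1" by (simp add: exp_add)
  \<comment> \<open>Since \<open>Re z + r\<close> is nonnegative, its exponential is at least
    1.\<close>
  moreover have "\<bar>Re z\<bar> \<le> r" using z abs_Re_le_cmod[of z] by linarith
  ultimately show False by simp
qed

subsection \<open>The operators H and I\<close>

lemma opnorm_mpow_le:
  fixes A :: "real^'n^'n"
  assumes "is_norm N"
  shows "N (mpow A j *v x) \<le> opnorm N N A ^ j * N x"
proof (induction j)
  case (Suc j)
  have "N (mpow A (Suc j) *v x) \<le> opnorm N N A * N (mpow A j *v x)"
    using opnorm_le[OF assms assms, of A "mpow A j *v x"] by (simp add: matrix_vector_mul_assoc)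
  also have "\<dots> \<le> opnorm N N A * (opnorm N N A ^ j * N x)"
    by (intro mult_left_mono Suc opnorm_nonneg assms)
  finally show ?case by (simp add: mult.assoc)
qed simp

lemma mexp_term_le:
  fixes A :: "real^'n^'n"
  assumes "is_norm N"
  shows "N ((t ^ j / fact j) *\<^sub>R (mpow A j *v x)) \<le> ((\<bar>t\<bar> * opnorm N N A) ^ j / fact j) * N x"
proof -
  have "N ((t ^ j / fact j) *\<^sub>R (mpow A j *v x)) = (\<bar>t\<bar> ^ j / fact j) * N (mpow A j *v x)"
    by (simp add: is_norm_scaleR[OF assms] power_abs)
  also have "\<dots> \<le> (\<bar>t\<bar> ^ j / fact j) * (opnorm N N A ^ j * N x)"
    by (intro mult_left_mono opnorm_mpow_le assms) simp
  finally show ?thesis by (simp add: power_mult_distrib)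
qed

lemma mexp_norm_le:
  fixes A :: "real^'n^'n"
  assumes "is_norm N"
  shows "N (mexp t A *v x) \<le> exp (\<bar>t\<bar> * opnorm N N A) * N x"
proof (rule is_norm_sums_le[OF assms mexp_mult_sums _ mexp_term_le[OF assms]])
  show "(\<lambda>j. ((\<bar>t\<bar> * opnorm N N A) ^ j / fact j) * N x) sums (exp (\<bar>t\<bar> * opnorm N N A) * N x)"
    using exp_converges[of "\<bar>t\<bar> * opnorm N N A"] by (intro sums_mult2) (simp add: field_simps)
qed

lemma mexp_minus_Lt_norm_le:
  fixes A :: "real^'n^'n"
  assumes "is_norm N"
  shows "N (mexp t A *v x - Lt A t k *v x) \<le> theta (\<bar>t\<bar> * opnorm N N A) k * N x"
proof (rule is_norm_sums_le[OF assms _ _ mexp_term_le[OF assms]])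
  show "(\<lambda>j. (t ^ (j + k) / fact (j + k)) *\<^sub>R (mpow A (j + k) *v x)) sums (mexp t A *v x - Lt A t k *v x)"
    using sums_split_initial_segment[OF mexp_mult_sums[of t A x], of k]
    by (simp add: Lt_def scaleR_matrix_vector_assoc
        bounded_bilinear.sum_left[OF bounded_bilinear_matrix_vector_mult])
  show "(\<lambda>j. ((\<bar>t\<bar> * opnorm N N A) ^ (j + k) / fact (j + k)) * N x) sums (theta (\<bar>t\<bar> * opnorm N N A) k * N x)"
    unfolding theta_def by (intro sums_mult2 summable_sums theta_summable)
qed

text \<open>The factor called \<open>e\<close> inside \<open>lam\<close>: it bounds the relative
  truncation error after pulling it back by the inverse exponential.\<close>

definition err :: "(real^'n \<Rightarrow> real) \<Rightarrow> real^'n^'n \<Rightarrow> real \<Rightarrow> nat \<Rightarrow> real" where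
  "err N A t k = exp (t * opnorm N N A) * theta (t * opnorm N N A) k"

lemma err_nonneg:
  assumes "is_norm N" "0 \<le> t"
  shows "0 \<le> err N A t k"
  unfolding err_def using assms by (intro mult_nonneg_nonneg theta_nonneg opnorm_nonneg) auto

text \<open>Lets the single factor \<open>lam\<close> computed at time \<open>t\<close> serve for
  all earlier times \<open>s\<close>.\<close>

lemma err_mono:
  assumes "is_norm N" "0 \<le> s" "s \<le> t"
  shows "err N A s k \<le> err N A t k"
  unfolding err_def using assms opnorm_nonneg[OF assms(1,1), of A]
  by (intro mult_mono theta_mono theta_nonneg) (auto intro: mult_right_mono)

lemma norm_mexp_minus_remainder_le:
  fixes A :: "real^'n^'n"
  assumes "is_norm N" "0 \<le> s"
  shows "N (mexp (- s) A *v (mexp s A *v x - Lt A s k *v x)) \<le> err N A s k * N x"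
proof -
  have "N (mexp (- s) A *v (mexp s A *v x - Lt A s k *v x))
      \<le> exp (s * opnorm N N A) * N (mexp s A *v x - Lt A s k *v x)"
    using mexp_norm_le[OF assms(1), of "- s"] assms(2) by simp
  also have "\<dots> \<le> exp (s * opnorm N N A) * (theta (s * opnorm N N A) k * N x)"
    using mexp_minus_Lt_norm_le[OF assms(1), of s] assms(2) by (intro mult_left_mono) auto
  finally show ?thesis by (simp add: err_def mult.assoc)
qed

lemma lam_eq:
  "lam Nn Np A t (c, G) k = (1 - err Nn A t k * opnorm Nn Np (pinv G) * Nn c)
     / (1 + err Nn A t k * opnorm Nn Np (pinv G) * opnorm Np Nn G)"
  by (simp add: lam_def err_def Let_def)

text \<open>Supplies the witnesses behind the least indices \<open>kappa\<close> and
  \<open>eta\<close>, as any \<open>eps < 1\<close> is eventually exceeded.\<close>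

lemma lam_tendsto_1: "(\<lambda>k. lam Nn Np A t cG k) \<longlonglongrightarrow> 1"
proof -
  obtain c G where cG: "cG = (c, G)" by (cases cG)
  have "(\<lambda>k. err Nn A t k) \<longlonglongrightarrow> 0"
    unfolding err_def
    using tendsto_mult_left[OF theta_tendsto_0, of "exp (t * opnorm Nn Nn A)" "t * opnorm Nn Nn A"] by simp
  then have "(\<lambda>k. lam Nn Np A t (c, G) k) \<longlonglongrightarrow>
    (1 - 0 * opnorm Nn Np (pinv G) * Nn c) / (1 + 0 * opnorm Nn Np (pinv G) * opnorm Np Nn G)"
    unfolding lam_eq by (intro tendsto_intros) auto
  then show ?thesis by (simp add: cG)
qed

text \<open>The value of \<^const>\<open>lam\<close> is the largest factor for which the norm bound on the corrected
  coefficient \<open>b'\<close> is at most \<open>1\<close>.\<close>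

lemma mexp_minus_Lt_in_zset:
  fixes A :: "real^'n^'n" and G :: "real^'p^'n"
  assumes Nn: "is_norm Nn" and Np: "is_norm Np" and G: "in_An (c, G)" and s: "0 \<le> s" "s \<le> t"
    and lam: "0 \<le> lam Nn Np A t (c, G) k" and b: "Np b \<le> 1"
  shows "mexp (- s) A *v (Lt A s k *v (c + lam Nn Np A t (c, G) k *\<^sub>R (G *v b))) \<in> zset Np (c, G)"
proof -
  define l where "l = lam Nn Np A t (c, G) k"
  define e g h where "e = err Nn A t k" and "g = opnorm Nn Np (pinv G)" and "h = opnorm Np Nn G"
  define x where "x = c + l *\<^sub>R (G *v b)"
  define y where "y = mexp (- s) A *v (mexp s A *v x - Lt A s k *v x)"
  define b' where "b' = l *\<^sub>R b - pinv G *v y"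
  have nonneg: "0 \<le> e" "0 \<le> g" "0 \<le> h" "0 \<le> l"
    using lam s by (auto simp: e_def g_def h_def l_def intro!: err_nonneg opnorm_nonneg Nn Np)
  have "mexp (- s) A *v (Lt A s k *v x) = x - y"
    by (simp add: y_def matrix_vector_mult_diff_distrib matrix_vector_mul_assoc mexp_minus_mult)
  also have "x - y = c + G *v b'"
    using pinv_right_inverse[of G] G
    by (simp add: b'_def x_def in_An_def matrix_vector_mult_diff_distrib matrix_vector_mul_assoc
        matrix_vector_mult_scaleR)
  finally have eq: "mexp (- s) A *v (Lt A s k *v x) = c + G *v b'" .
  have "Nn x \<le> Nn c + l * Nn (G *v b)"
    using is_norm_triangle[OF Nn, of c "l *\<^sub>R (G *v b)"] nonneg by (simp add: x_def is_norm_scaleR[OF Nn])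
  moreover have "Nn (G *v b) \<le> h"
    using opnorm_le[OF Np Nn, of G b] mult_left_mono[OF b nonneg(3)] by (simp add: h_def)
  ultimately have x: "Nn x \<le> Nn c + l * h" using nonneg by (meson add_left_mono mult_left_mono order_trans)
  have "Nn y \<le> err Nn A s k * Nn x" unfolding y_def by (rule norm_mexp_minus_remainder_le[OF Nn s(1)])
  also have "\<dots> \<le> e * Nn x"
    unfolding e_def by (intro mult_right_mono err_mono Nn s is_norm_nonneg)
  also have "\<dots> \<le> e * (Nn c + l * h)" using x nonneg by (intro mult_left_mono)
  finally have y: "Nn y \<le> e * (Nn c + l * h)" .
  have "Np b' \<le> l * Np b + Np (pinv G *v y)"
    using is_norm_diff[OF Np, of "l *\<^sub>R b" "pinv G *v y"] nonneg by (simp add: b'_def is_norm_scaleR[OF Np])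
  also have "\<dots> \<le> l + g * (e * (Nn c + l * h))"
    using mult_left_mono[OF b nonneg(4)] opnorm_le[OF Nn Np, of "pinv G" y] mult_left_mono[OF y nonneg(2)]
    by (simp add: g_def)
  also have "\<dots> = l * (1 + e * g * h) + e * g * Nn c" by (simp add: algebra_simps)
  \<comment> \<open>This is the definition of \<open>lam\<close> with its positive denominator
    cleared; the remaining summand \<open>e * g * Nn c\<close> then cancels and leaves exactly
    1.\<close>
  also have "l * (1 + e * g * h) = 1 - e * g * Nn c"
  proof -
    have "1 + e * g * h > 0" using nonneg by (intro add_pos_nonneg mult_nonneg_nonneg) auto
    then show ?thesis by (simp add: l_def lam_eq e_def g_def h_def)
  qed
  finally have "Np b' \<le> 1" by simp
  with eq show ?thesis by (auto simp: zset_def unit_ball_def x_def l_def)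
qed

text \<open>Full row rank amounts to having a right inverse, and one is built from
  \<open>pinv G\<close>, the inverse of \<open>M\<close> and \<open>1 / l\<close>.\<close>

lemma in_An_scaled_mult:
  fixes G :: "real^'p^'n"
  assumes G: "in_An (c, G)" and M: "invertible M" and l: "l \<noteq> 0"
  shows "in_An (c', l *\<^sub>R (M ** G))"
proof -
  obtain M' where M': "M ** M' = mat 1" using M by (auto simp: invertible_def)
  have "(l *\<^sub>R (M ** G)) ** ((1 / l) *\<^sub>R (pinv G ** M')) = M ** (G ** pinv G) ** M'"
    using l by (simp add: bounded_bilinear.scaleR_left[OF bounded_bilinear_matrix_mult]
        bounded_bilinear.scaleR_right[OF bounded_bilinear_matrix_mult] matrix_mul_assoc)
  also have "\<dots> = mat 1"
    using pinv_right_inverse[of G] G M' by (simp add: in_An_def)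
  finally have "surj ((*v) (l *\<^sub>R (M ** G)))"
    using matrix_right_invertible_surjective by blast
  then show ?thesis by (simp add: in_An_def full_rank_surjective)
qed

lemma zset_scaled_mult: "zset Np (M *v c, l *\<^sub>R (M ** G)) = {M *v (c + l *\<^sub>R (G *v b)) | b. Np b \<le> 1}"
  by (simp add: zset_def unit_ball_def matrix_vector_right_distrib matrix_vector_mult_scaleR
      scaleR_matrix_vector_assoc[symmetric] matrix_vector_mul_assoc)

lemma kappa_properties:
  fixes Nn :: "real^'n \<Rightarrow> real" and Np :: "real^'p \<Rightarrow> real"
    and A :: "real^'n^'n" and cG :: "(real^'n) \<times> (real^'p^'n)"
  assumes "0 \<le> t" "eps < 1"
  defines "k \<equiv> kappa Nn Np A t cG eps"
  shows "kmin A t \<le> k" "2 \<le> k" "eps < lam Nn Np A t cG k"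
proof -
  have "eventually (\<lambda>k. max (kmin A t) 2 \<le> k \<and> eps < lam Nn Np A t cG k) sequentially"
    using order_tendstoD(1)[OF lam_tendsto_1[of Nn Np A t cG] assms(2)]
    by (intro eventually_conj eventually_ge_at_top)
  then have "\<exists>k. max (kmin A t) 2 \<le> k \<and> eps < lam Nn Np A t cG k"
    by (rule eventually_happens'[OF sequentially_bot])
  then have "max (kmin A t) 2 \<le> k \<and> eps < lam Nn Np A t cG k"
    unfolding k_def kappa_def by (rule LeastI_ex)
  then show "kmin A t \<le> k" "2 \<le> k" "eps < lam Nn Np A t cG k" by auto
qed

text \<open>The determinant is continuous and nonzero at the limit of \<open>Tt A t k\<close>, so it
  is nonzero for all large \<open>k\<close>; \<open>lam\<close> eventually exceeds
  \<open>eps\<close> as well.\<close>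

lemma eta_properties:
  fixes Nn :: "real^'n \<Rightarrow> real" and Np :: "real^'p \<Rightarrow> real"
    and A :: "real^'n^'n" and cG :: "(real^'n) \<times> (real^'p^'n)"
  assumes I: "in_I A t" and "eps < 1"
  defines "k \<equiv> eta Nn Np A t cG eps"
  shows "eps < lam Nn Np A t cG k" "invertible (Tt A t k)"
proof -
  let ?J = "integral {0..t} (\<lambda>s. mexp s A)"
  have t: "0 \<le> t" and "det ?J \<noteq> 0" using I by (auto simp: in_I_def invertible_det_nz)
  have "(\<lambda>k. det (Tt A t k)) \<longlonglongrightarrow> det ?J"
    unfolding det_def by (intro tendsto_intros Tt_tendsto t)
  then have "eventually (\<lambda>k. det (Tt A t k) \<noteq> 0) sequentially"
    using \<open>det ?J \<noteq> 0\<close> by (rule tendsto_imp_eventually_ne)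
  then have "eventually (\<lambda>k. eps < lam Nn Np A t cG k \<and> invertible (Tt A t k)) sequentially"
    using order_tendstoD(1)[OF lam_tendsto_1[of Nn Np A t cG] assms(2)]
    by eventually_elim (simp add: invertible_det_nz)
  then have "\<exists>k. eps < lam Nn Np A t cG k \<and> invertible (Tt A t k)"
    by (rule eventually_happens'[OF sequentially_bot])
  then have "eps < lam Nn Np A t cG k \<and> invertible (Tt A t k)"
    unfolding k_def eta_def by (rule LeastI_ex)
  then show "eps < lam Nn Np A t cG k" "invertible (Tt A t k)" by auto
qed

lemma Hop_properties:
  fixes A :: "real^'n^'n" and cG :: "(real^'n) \<times> (real^'p^'n)"
  assumes Nn: "is_norm Nn" and Np: "is_norm Np" and An: "in_An cG" and t: "0 \<le> t" and eps: "0 \<le> eps" "eps < 1"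
  shows "in_An (Hop Nn Np A t eps cG)"
    and "zset Np (Hop Nn Np A t eps cG) \<subseteq> (\<lambda>x. mexp t A *v x) ` zset Np cG"
proof -
  obtain c G where cG: "cG = (c, G)" by (cases cG)
  define k where "k = kappa Nn Np A t (c, G) eps"
  define l where "l = lam Nn Np A t (c, G) k"
  note k = kappa_properties[OF t eps(2), where Nn = Nn and Np = Np and A = A and cG = "(c, G)", folded k_def]
  \<comment> \<open>Positivity of the factor, from \<open>0 \<le> eps\<close>, serves both claims:
    scaling then preserves the rank, and the inclusion requires a nonnegative factor.\<close>
  have l: "0 < l" using k(3) eps by (simp add: l_def)
  have Hop: "Hop Nn Np A t eps cG = (Lt A t k *v c, l *\<^sub>R (Lt A t k ** G))"
    by (simp add: Hop_def cG k_def l_def Let_def)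
  show "in_An (Hop Nn Np A t eps cG)"
    unfolding Hop using An k l t by (intro in_An_scaled_mult[of c] invertible_Lt) (auto simp: cG)
  show "zset Np (Hop Nn Np A t eps cG) \<subseteq> (\<lambda>x. mexp t A *v x) ` zset Np cG"
    unfolding Hop zset_scaled_mult
  proof clarify
    fix b assume "Np b \<le> 1"
    then have "mexp (- t) A *v (Lt A t k *v (c + l *\<^sub>R (G *v b))) \<in> zset Np cG"
      unfolding cG l_def using An t l
      by (intro mexp_minus_Lt_in_zset Nn Np) (auto simp: cG l_def)
    then show "Lt A t k *v (c + l *\<^sub>R (G *v b)) \<in> (\<lambda>x. mexp t A *v x) ` zset Np cG"
      by (rule rev_image_eqI) (simp add: matrix_vector_mul_assoc matrix_mul_assoc mexp_mult_minus)
  qed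
qed

lemma Iop_properties:
  fixes A :: "real^'n^'n" and cG :: "(real^'n) \<times> (real^'p^'n)"
  assumes Nn: "is_norm Nn" and Np: "is_norm Np" and An: "in_An cG" and I: "in_I A t" and eps: "0 \<le> eps" "eps < 1"
  shows "in_An (Iop Nn Np A t eps cG)"
    and "zset Np (Iop Nn Np A t eps cG) \<subseteq> Ru A (zset Np cG) t"
proof -
  obtain c G where cG: "cG = (c, G)" by (cases cG)
  define k where "k = eta Nn Np A t (c, G) eps"
  define l where "l = lam Nn Np A t (c, G) k"
  note k = eta_properties[OF I eps(2), where Nn = Nn and Np = Np and cG = "(c, G)", folded k_def]
  have l: "0 < l" using k(1) eps by (simp add: l_def)
  have t: "0 \<le> t" using I by (simp add: in_I_def)
  have Iop: "Iop Nn Np A t eps cG = (Tt A t k *v c, l *\<^sub>R (Tt A t k ** G))"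
    by (simp add: Iop_def cG k_def l_def Let_def)
  show "in_An (Iop Nn Np A t eps cG)"
    unfolding Iop using An k l by (intro in_An_scaled_mult[of c]) (auto simp: cG)
  show "zset Np (Iop Nn Np A t eps cG) \<subseteq> Ru A (zset Np cG) t"
    unfolding Iop zset_scaled_mult
  proof clarify
    fix b assume b: "Np b \<le> 1"
    define x where "x = c + l *\<^sub>R (G *v b)"
    \<comment> \<open>Chosen so that the exponential in the integrand cancels and leaves the
      truncation, whose integral is \<open>Tt A t k *v x\<close>.\<close>
    define w where "w = (\<lambda>s. mexp (- s) A *v (Lt A s k *v x))"
    have "((\<lambda>s. Lt A s k *v x) has_integral Tt A t k *v x) {0..t}"
      using has_integral_linear[OF Lt_has_integral[OF t, of A k]
          bounded_bilinear.bounded_linear_left[OF bounded_bilinear_matrix_vector_mult, of x]]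
      by (simp add: o_def)
    moreover have "mexp s A *v w s = Lt A s k *v x" for s
      by (simp add: w_def matrix_vector_mul_assoc matrix_mul_assoc mexp_mult_minus)
    ultimately have "integral {0..t} (\<lambda>s. mexp s A *v w s) = Tt A t k *v x"
      by (simp add: integral_unique)
    moreover have "w \<in> borel_measurable (lebesgue_on {0..t})"
    proof (rule continuous_imp_measurable_on_sets_lebesgue)
      have "continuous_on {0..t} (\<lambda>s. mexp (- s) A)"
        by (rule continuous_on_compose2[OF continuous_on_mexp[of UNIV]]) (auto intro: continuous_intros)
      moreover have "continuous_on {0..t} (\<lambda>s. Lt A s k)"
        unfolding Lt_def by (intro continuous_intros) auto
      ultimately show "continuous_on {0..t} w"
        unfolding w_def
        by (intro bounded_bilinear.continuous_on[OF bounded_bilinear_matrix_vector_mult] continuous_on_const)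
    qed simp
    moreover have "\<forall>s\<in>{0..t}. w s \<in> zset Np cG"
      using An l b unfolding w_def x_def l_def cG
      by (auto intro!: mexp_minus_Lt_in_zset Nn Np simp: cG l_def)
    ultimately show "Tt A t k *v (c + l *\<^sub>R (G *v b)) \<in> Ru A (zset Np cG) t"
      unfolding Ru_def x_def by (auto intro!: exI[of _ w])
  qed
qed

subsection \<open>Reachable sets\<close>

lemma bounded_zset:
  fixes G :: "real^'p^'n"
  assumes "is_norm Np"
  shows "bounded (zset Np (c, G))"
proof -
  have "bounded ((\<lambda>b. G *v b) ` unit_ball Np)"
    by (intro bounded_linear_image bounded_unit_ball assms) (rule matrix_vector_mul_bounded_linear)
  then have "bounded ((+) c ` ((\<lambda>b. G *v b) ` unit_ball Np))"
    by (rule bounded_translation)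
  moreover have "(+) c ` ((\<lambda>b. G *v b) ` unit_ball Np) = zset Np (c, G)"
    by (auto simp: zset_def)
  ultimately show ?thesis by simp
qed

lemma zset_nonempty: "is_norm Np \<Longrightarrow> zset Np cG \<noteq> {}"
  by (auto simp: zset_def unit_ball_def is_norm_zero intro!: exI[of _ 0])

text \<open>A measurable control with values in a bounded set gives a bounded measurable integrand
  on a compact interval. Splitting the integral relies on this.\<close>

lemma integrable_mexp_mult:
  fixes A :: "real^'n^'n"
  assumes U: "bounded U" and w: "w \<in> borel_measurable (lebesgue_on {a..b})" "\<And>s. s \<in> {a..b} \<Longrightarrow> w s \<in> U"
  shows "(\<lambda>s. mexp s A *v w s) integrable_on {a..b}"
proof -
  obtain K where K: "K > 0" "\<And>(M :: real^'n^'n) (x :: real^'n). norm (M *v x) \<le> norm M * norm x * K"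
    using bounded_bilinear.pos_bounded[OF bounded_bilinear_matrix_vector_mult] by blast
  obtain B where B: "\<And>x. x \<in> U \<Longrightarrow> norm x \<le> B" using U by (auto simp: bounded_iff)
  have "compact ((\<lambda>s. mexp s A) ` {a..b})"
    by (intro compact_continuous_image continuous_on_mexp) simp
  then obtain E where E: "\<And>s. s \<in> {a..b} \<Longrightarrow> norm (mexp s A) \<le> E"
    by (meson bounded_iff compact_imp_bounded imageI)
  show ?thesis
  proof (rule measurable_bounded_by_integrable_imp_integrable)
    have "(\<lambda>s. mexp s A) \<in> borel_measurable (lebesgue_on {a..b})"
      by (intro continuous_imp_measurable_on_sets_lebesgue continuous_on_mexp) simp
    then show "(\<lambda>s. mexp s A *v w s) \<in> borel_measurable (lebesgue_on {a..b})"
      using w(1) by (rule borel_measurable_continuous_Pair)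
        (intro bounded_bilinear.continuous_on[OF bounded_bilinear_matrix_vector_mult] continuous_intros)
    show "norm (mexp s A *v w s) \<le> E * B * K" if "s \<in> {a..b}" for s
    proof -
      have "norm (mexp s A) * norm (w s) \<le> E * B"
        using E[OF that] B[OF w(2)[OF that]] norm_ge_zero[of "mexp s A"] norm_ge_zero[of "w s"]
        by (intro mult_mono) linarith+
      then show ?thesis using K(1) K(2)[of "mexp s A" "w s"] by (meson mult_right_mono less_imp_le order_trans)
    qed
  qed auto
qed

text \<open>Extension by 0 to the whole line reduces the claim to Lebesgue measurability of a
  translation.\<close>

lemma borel_measurable_shift:
  fixes f :: "real \<Rightarrow> 'b::euclidean_space"
  assumes "f \<in> borel_measurable (lebesgue_on {a..b})"
  shows "(\<lambda>x. f (x + c)) \<in> borel_measurable (lebesgue_on {a - c..b - c})"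
proof (rule borel_measurable_if_D)
  have "(\<lambda>x. if x \<in> {a..b} then f x else 0) \<in> borel_measurable lebesgue"
    by (intro borel_measurable_if_I assms) simp
  moreover have "(\<lambda>x. c + x) \<in> lebesgue \<rightarrow>\<^sub>M lebesgue"
    using lebesgue_affine_measurable[of "\<lambda>_. 1" c] by simp
  ultimately have "(\<lambda>x. if c + x \<in> {a..b} then f (c + x) else 0) \<in> borel_measurable lebesgue"
    by (rule measurable_compose[rotated])
  moreover have "(\<lambda>x. if c + x \<in> {a..b} then f (c + x) else 0)
      = (\<lambda>x. if x \<in> {a - c..b - c} then f (x + c) else 0)"
    by (auto simp: fun_eq_iff algebra_simps)
  ultimately show "(\<lambda>x. if x \<in> {a - c..b - c} then f (x + c) else 0) \<in> borel_measurable lebesgue"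
    by simp
qed

lemma borel_measurable_concat:
  fixes f g :: "real \<Rightarrow> 'b::euclidean_space"
  assumes f: "f \<in> borel_measurable (lebesgue_on {a..c})" and g: "g \<in> borel_measurable (lebesgue_on {c..b})"
  shows "(\<lambda>x. if x < c then f x else g x) \<in> borel_measurable (lebesgue_on {a..b})"
proof (rule borel_measurable_if_D)
  let ?f = "\<lambda>x. if x \<in> {a..c} then f x else 0" and ?g = "\<lambda>x. if x \<in> {c..b} then g x else 0"
  have fg: "?f \<in> borel_measurable lebesgue" "?g \<in> borel_measurable lebesgue"
    by (rule borel_measurable_if_I[OF f], simp) (rule borel_measurable_if_I[OF g], simp)
  have "(\<lambda>x. if x \<in> {..<c} then ?f x else ?g x) \<in> borel_measurable lebesgue"
    by (intro measurable_If_set fg) auto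
  then have "(\<lambda>x. if x \<in> {a..b} then (if x \<in> {..<c} then ?f x else ?g x) else 0) \<in> borel_measurable lebesgue"
    by (rule measurable_If_set) auto
  moreover have "(\<lambda>x. if x \<in> {a..b} then (if x \<in> {..<c} then ?f x else ?g x) else 0)
    = (\<lambda>x. if x \<in> {a..b} then (if x < c then f x else g x) else 0)"
    by (auto simp: fun_eq_iff)
  ultimately show "(\<lambda>x. if x \<in> {a..b} then (if x < c then f x else g x) else 0) \<in> borel_measurable lebesgue"
    by simp
qed

text \<open>On the second interval substitute \<open>r + s\<close> for \<open>r\<close>; the
  semigroup law then pulls the constant factor \<open>mexp s A\<close> out of the integral.\<close>

lemma Ru_integral_split:
  fixes A :: "real^'n^'n"
  assumes U: "bounded U" and st: "0 \<le> s" "0 \<le> t"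
    and w: "w \<in> borel_measurable (lebesgue_on {0..s + t})" "\<And>r. r \<in> {0..s + t} \<Longrightarrow> w r \<in> U"
  shows "integral {0..s + t} (\<lambda>r. mexp r A *v w r)
    = integral {0..s} (\<lambda>r. mexp r A *v w r) + mexp s A *v integral {0..t} (\<lambda>r. mexp r A *v w (r + s))"
proof -
  have "(\<lambda>r. w (r + s)) \<in> borel_measurable (lebesgue_on {0..t})"
    using borel_measurable_shift[OF measurable_restrict_mono[OF w(1)], of s "s + t" s] st by simp
  then have int: "(\<lambda>r. mexp r A *v w (r + s)) integrable_on {0..t}"
    using w(2) st by (intro integrable_mexp_mult[OF U]) auto
  have "integral {s..s + t} (\<lambda>r. mexp r A *v w r) = integral {0..t} (\<lambda>r. mexp (r + s) A *v w (r + s))"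
    using integral_shift_real_ivl[of s s "s + t" "\<lambda>r. mexp r A *v w r"] by simp
  also have "\<dots> = integral {0..t} (\<lambda>r. mexp s A *v (mexp r A *v w (r + s)))"
    by (simp add: add.commute[of _ s] mexp_add matrix_vector_mul_assoc)
  also have "\<dots> = mexp s A *v integral {0..t} (\<lambda>r. mexp r A *v w (r + s))"
    using integral_linear[OF int matrix_vector_mul_bounded_linear[of "mexp s A"]] by (simp add: o_def)
  finally show ?thesis
    using Henstock_Kurzweil_Integration.integral_combine[OF _ _ integrable_mexp_mult[OF U w], of s A] st
    by simp
qed

text \<open>A control on \<open>{0..s + t}\<close> corresponds to a control on \<open>{0..s}\<close>
  followed by a shifted control on \<open>{0..t}\<close>: restrict one way, concatenate the
  other.\<close>

lemma Ru_add:
  fixes A :: "real^'n^'n"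
  assumes U: "bounded U" and st: "0 \<le> s" "0 \<le> t"
  shows "Ru A U (s + t) = msum (Ru A U s) ((\<lambda>x. mexp s A *v x) ` Ru A U t)"
proof (intro equalityI subsetI)
  fix x assume "x \<in> Ru A U (s + t)"
  then obtain w where w: "w \<in> borel_measurable (lebesgue_on {0..s + t})" "\<And>r. r \<in> {0..s + t} \<Longrightarrow> w r \<in> U"
    and x: "x = integral {0..s + t} (\<lambda>r. mexp r A *v w r)"
    by (auto simp: Ru_def)
  have "w \<in> borel_measurable (lebesgue_on {0..s})"
    using st by (intro measurable_restrict_mono[OF w(1)]) auto
  then have "integral {0..s} (\<lambda>r. mexp r A *v w r) \<in> Ru A U s"
    using w(2) st by (auto simp: Ru_def)
  moreover have "(\<lambda>r. w (r + s)) \<in> borel_measurable (lebesgue_on {0..t})"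
    using borel_measurable_shift[OF measurable_restrict_mono[OF w(1)], of s "s + t" s] st by simp
  then have "integral {0..t} (\<lambda>r. mexp r A *v w (r + s)) \<in> Ru A U t"
    using w(2) st unfolding Ru_def by (auto intro!: exI[of _ "\<lambda>r. w (r + s)"])
  ultimately show "x \<in> msum (Ru A U s) ((\<lambda>x. mexp s A *v x) ` Ru A U t)"
    unfolding msum_def using x Ru_integral_split[OF U st w, of A] by blast
next
  fix x assume "x \<in> msum (Ru A U s) ((\<lambda>x. mexp s A *v x) ` Ru A U t)"
  then obtain w1 w2 where
      w1: "w1 \<in> borel_measurable (lebesgue_on {0..s})" "\<And>r. r \<in> {0..s} \<Longrightarrow> w1 r \<in> U"
    and w2: "w2 \<in> borel_measurable (lebesgue_on {0..t})" "\<And>r. r \<in> {0..t} \<Longrightarrow> w2 r \<in> U"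
    and x: "x = integral {0..s} (\<lambda>r. mexp r A *v w1 r) + mexp s A *v integral {0..t} (\<lambda>r. mexp r A *v w2 r)"
    unfolding msum_def Ru_def by blast
  define w where "w = (\<lambda>r. if r < s then w1 r else w2 (r - s))"
  have "(\<lambda>r. w2 (r - s)) \<in> borel_measurable (lebesgue_on {s..s + t})"
    using borel_measurable_shift[OF w2(1), of "- s"] by (simp add: add.commute)
  with w1(1) have meas: "w \<in> borel_measurable (lebesgue_on {0..s + t})"
    unfolding w_def by (rule borel_measurable_concat)
  have U': "w r \<in> U" if "r \<in> {0..s + t}" for r
    using that w1(2) w2(2) by (auto simp: w_def)
  \<comment> \<open>At the junction \<open>s\<close> the concatenation takes the value
    \<open>w2 0\<close>, so it may differ from \<open>w1\<close> there, on a null set.\<close>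
  have "integral {0..s} (\<lambda>r. mexp r A *v w r) = integral {0..s} (\<lambda>r. mexp r A *v w1 r)"
    by (rule integral_spike[of "{s}"]) (auto simp: w_def)
  moreover have "integral {0..t} (\<lambda>r. mexp r A *v w (r + s)) = integral {0..t} (\<lambda>r. mexp r A *v w2 r)"
    by (rule Henstock_Kurzweil_Integration.integral_cong) (auto simp: w_def)
  ultimately have "x = integral {0..s + t} (\<lambda>r. mexp r A *v w r)"
    unfolding x using Ru_integral_split[OF U st meas U'] by simp
  then show "x \<in> Ru A U (s + t)"
    using meas U' unfolding Ru_def by blast
qed

lemma Ru_0:
  fixes A :: "real^'n^'n"
  assumes "U \<noteq> {}"
  shows "Ru A U 0 = {0}"
proof -
  obtain u where "u \<in> U" using assms by blast
  have "integral {0..0} f = 0" for f :: "real \<Rightarrow> real^'n"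
    using integral_refl[of 0 f] by simp
  \<comment> \<open>A constant control shows that the set is not empty; every integral over a single
    point is 0.\<close>
  then show ?thesis
    using \<open>u \<in> U\<close> unfolding Ru_def by (auto intro!: exI[of _ "\<lambda>_. u"] simp del: atLeastAtMost_singleton)
qed

section \<open>Iterating the recursions\<close>

lemma funpow_image_mexp:
  fixes A :: "real^'n^'n"
  shows "(((`) (\<lambda>x. mexp t A *v x)) ^^ i) X = (\<lambda>x. mexp (real i * t) A *v x) ` X"
proof (induction i)
  case (Suc i)
  have "mexp (real (Suc i) * t) A = mexp t A ** mexp (real i * t) A"
    by (simp add: mexp_add[symmetric] algebra_simps)
  then show ?case by (simp add: Suc image_image matrix_vector_mul_assoc)
qed (simp add: mexp_0)

text \<open>Each step of the iteration is \<open>Ru_add\<close> with first duration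
  \<open>real i * t\<close> and second duration \<open>t\<close>.\<close>

lemma msum_iter_Ru:
  fixes A :: "real^'n^'n"
  assumes U: "bounded U" "U \<noteq> {}" and t: "0 \<le> t"
  shows "msum_iter (\<lambda>i. (((`) (\<lambda>x. mexp t A *v x)) ^^ i) (Ru A U t)) i = Ru A U (real i * t)"
proof (induction i)
  case (Suc i)
  have "real (Suc i) * t = real i * t + t" by (simp add: algebra_simps)
  then show ?case using Ru_add[OF U(1), of "real i * t" t A] t Suc by (simp add: funpow_image_mexp)
qed (simp add: Ru_0[OF U(2)])

lemma msum_mono: "X \<subseteq> X' \<Longrightarrow> Y \<subseteq> Y' \<Longrightarrow> msum X Y \<subseteq> msum X' Y'"
  unfolding msum_def by blast

lemma msum_iter_mono:
  assumes "\<And>i. F i \<subseteq> G i"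
  shows "msum_iter F i \<subseteq> msum_iter G i"
  by (induction i) (simp_all add: msum_mono assms)

text \<open>Rank and inclusion go through one induction, since \<open>Hop\<close> needs full rank at
  every step. The set \<open>X\<close> is arbitrary so that it covers both the initial set and the
  input reachable set.\<close>

lemma Hop_funpow:
  fixes A :: "real^'n^'n" and cG :: "(real^'n) \<times> (real^'p^'n)"
  assumes "is_norm Nn" "is_norm Np" "in_An cG" "0 \<le> t" "0 \<le> eps" "eps < 1" and sub: "zset Np cG \<subseteq> X"
  shows "in_An ((Hop Nn Np A t eps ^^ i) cG)
    \<and> zset Np ((Hop Nn Np A t eps ^^ i) cG) \<subseteq> (((`) (\<lambda>x. mexp t A *v x)) ^^ i) X"
proof (induction i)
  case (Suc i)
  then show ?case
    using Hop_properties[OF assms(1,2) _ assms(4-6), of "(Hop Nn Np A t eps ^^ i) cG"]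
    by simp (meson image_mono order_trans)
qed (simp add: assms)

theorem theorem1:
  fixes Nn :: "real^'n \<Rightarrow> real" and Nx :: "real^'px \<Rightarrow> real" and Nu :: "real^'pu \<Rightarrow> real"
    and A :: "real^'n^'n" and T :: real
    and cx :: "real^'n" and Gx :: "real^'px^'n" and cu :: "real^'n" and Gu :: "real^'pu^'n"
    and N :: nat and eh eu \<tau> :: real
  assumes "is_norm Nn" and "is_norm Nx" and "is_norm Nu"
    and "T > 0"
    and "in_An (cx, Gx)" and "in_An (cu, Gu)"
    and "0 \<le> eh" and "eh < 1" and "0 \<le> eu" and "eu < 1"
    and tau: "\<tau> = T / real N"
    and "in_I A \<tau>"
  defines "X0 \<equiv> zset Nx (cx, Gx)" defines "U \<equiv> zset Nu (cu, Gu)"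
  defines "Srep \<equiv> \<lambda>i. (Hop Nn Nx A \<tau> eh ^^ i) (cx, Gx)"
  defines "Vrep \<equiv> \<lambda>i. (Hop Nn Nu A \<tau> eh ^^ i) (Iop Nn Nu A \<tau> eu (cu, Gu))"
  defines "Sc \<equiv> \<lambda>i. zset Nx (Srep i)"
  defines "Vc \<equiv> \<lambda>i. zset Nu (Vrep i)"
  defines "Wc \<equiv> msum_iter Vc"
  defines "Lam \<equiv> \<lambda>i. msum (Sc i) (Wc i)"
  defines "S \<equiv> \<lambda>i. (((`) (\<lambda>x. mexp \<tau> A *v x)) ^^ i) X0"
  defines "V \<equiv> \<lambda>i. (((`) (\<lambda>x. mexp \<tau> A *v x)) ^^ i) (Ru A U \<tau>)"
  defines "W \<equiv> msum_iter V"
  defines "Gam \<equiv> \<lambda>i. msum (S i) (W i)"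
  shows "(\<forall>i\<le>N. Sc i \<subseteq> S i \<and> S i = Rh A X0 (real i * \<tau>)
              \<and> Vc i \<subseteq> V i
              \<and> Wc i \<subseteq> W i \<and> W i = Ru A U (real i * \<tau>)
              \<and> Lam i \<subseteq> Gam i \<and> Gam i = R A X0 U (real i * \<tau>))
         \<and> (\<Union>i\<in>{0..N}. Lam i) \<subseteq> R_interval A X0 U T"
proof -
  have t: "0 \<le> \<tau>" using \<open>in_I A \<tau>\<close> by (simp add: in_I_def)
  have Sc: "Sc i \<subseteq> S i" for i
    using Hop_funpow[OF \<open>is_norm Nn\<close> \<open>is_norm Nx\<close> \<open>in_An (cx, Gx)\<close> t \<open>0 \<le> eh\<close> \<open>eh < 1\<close> subset_refl]
    by (simp add: Sc_def S_def Srep_def X0_def)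
  have S: "S i = Rh A X0 (real i * \<tau>)" for i
    by (simp add: S_def Rh_def funpow_image_mexp)
  note Iop = Iop_properties[OF \<open>is_norm Nn\<close> \<open>is_norm Nu\<close> \<open>in_An (cu, Gu)\<close> \<open>in_I A \<tau>\<close> \<open>0 \<le> eu\<close> \<open>eu < 1\<close>]
  \<comment> \<open>Here the iteration starts from the inclusion of the set given by
    \<open>Iop\<close> in \<open>Ru A U \<tau>\<close>.\<close>
  have Vc: "Vc i \<subseteq> V i" for i
    using Hop_funpow[OF \<open>is_norm Nn\<close> \<open>is_norm Nu\<close> Iop(1) t \<open>0 \<le> eh\<close> \<open>eh < 1\<close> Iop(2)]
    by (simp add: Vc_def V_def Vrep_def U_def)
  have Wc: "Wc i \<subseteq> W i" for i
    unfolding Wc_def W_def by (rule msum_iter_mono) (rule Vc)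
  have W: "W i = Ru A U (real i * \<tau>)" for i
    unfolding W_def V_def
    by (rule msum_iter_Ru) (simp_all add: U_def bounded_zset zset_nonempty t \<open>is_norm Nu\<close>)
  have Lam: "Lam i \<subseteq> Gam i" for i
    unfolding Lam_def Gam_def by (rule msum_mono[OF Sc Wc])
  have Gam: "Gam i = R A X0 U (real i * \<tau>)" for i
    by (simp add: Gam_def R_def S W)
  have "Lam i \<subseteq> R_interval A X0 U T" if "i \<in> {0..N}" for i
  proof -
    \<comment> \<open>For \<open>N = 0\<close> only \<open>i = 0\<close> occurs, and the product is
      0; otherwise \<open>i \<le> N\<close> gives the bound.\<close>
    have "real i * \<tau> \<le> T"
      using that \<open>T > 0\<close> by (cases "N = 0") (simp_all add: tau field_simps)
    then have "real i * \<tau> \<in> {0..T}" using t by simp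
    then have "R A X0 U (real i * \<tau>) \<subseteq> R_interval A X0 U T"
      unfolding R_interval_def by blast
    then show ?thesis using Lam[of i] Gam[of i] by simp
  qed
  then show ?thesis by (intro conjI allI impI UN_least Sc S Vc Wc W Lam Gam)
qed

end
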